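(* Let $\lambda,\mu$ be partitions and let $\hat\mu=(\mu_2,\dots,\mu_{\ell(\mu)})$ be the partition obtained by removing the first part of $\mu$. If $r_\lambda^\mu>0$, then $|\lambda\cap\hat\mu|\ge 2|\hat\mu|-|\lambda|$.
   Context: For a partition $\mu$ with $|\mu|=n$, $V_\mu$ is the Specht module of $\mathfrak S_n$; $\mathbb{S}^\lambda$ is the Schur functor over $\mathbb{C}$; $r_\lambda^\mu=\dim\operatorname{Hom}_{\mathfrak S_n}(V_\mu,\mathbb{S}^\lambda\mathbb{C}^n)$ with $n=|\mu|$ and $\mathfrak S_n$ acting on $\mathbb{C}^n$ by permutation matrices. For partitions $\lambda,\mu$, $\lambda\cap\mu$ is the partition with $(\lambda\cap\mu)_i=\min(\lambda_i,\mu_i)$ (Young diagram intersection), and $|\cdot|$ denotes size. *)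

theory Defs
  imports Complex_Main "HOL-Combinatorics.Permutations" "HOL-Library.Function_Algebras"
begin

definition is_partition :: "nat list \<Rightarrow> bool" where
  "is_partition la \<longleftrightarrow> (\<forall>x\<in>set la. 0 < x) \<and> sorted_wrt (\<ge>) la"

definition psize :: "nat list \<Rightarrow> nat" where
  "psize la = sum_list la"

text \<open>Young diagram intersection: parts are pointwise minima (missing parts are 0).\<close>
definition pinter :: "nat list \<Rightarrow> nat list \<Rightarrow> nat list" where
  "pinter la mu = map (\<lambda>(a, b). min a b) (zip la mu)"

definition hat :: "nat list \<Rightarrow> nat list" where
  "hat mu = tl mu"

definition diagram :: "nat list \<Rightarrow> (nat \<times> nat) set" where
  "diagram la = {(i, j). i < length la \<and> j < la ! i}"

definition fscale :: "complex \<Rightarrow> ('a \<Rightarrow> complex) \<Rightarrow> ('a \<Rightarrow> complex)" where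
  "fscale c F = (\<lambda>x. c * F x)"

definition mscale :: "complex \<Rightarrow> ('a \<Rightarrow> 'b \<Rightarrow> complex) \<Rightarrow> ('a \<Rightarrow> 'b \<Rightarrow> complex)" where
  "mscale c h = (\<lambda>x y. c * h x y)"

text \<open>S_n acts on {0..<n}. A tableau of shape mu is encoded by the bijection
  T : {0..<n} -> cells, T k = cell containing entry k. A tabloid is encoded by the list
  (of length n) whose k-th entry is the row containing k. M^mu is the space of
  complex functions on such lists; tabloid {t} corresponds to its indicator function.\<close>

definition tableaux :: "nat list \<Rightarrow> (nat \<Rightarrow> nat \<times> nat) set" where
  "tableaux mu = {T. bij_betw T {..<psize mu} (diagram mu)}"

definition column_group :: "nat \<Rightarrow> (nat \<Rightarrow> nat \<times> nat) \<Rightarrow> (nat \<Rightarrow> nat) set" where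
  "column_group n T = {s. s permutes {..<n} \<and> (\<forall>k<n. snd (T (s k)) = snd (T k))}"

text \<open>Tabloid of the tableau s.t, where s.t places entry s k in the cell of k.\<close>
definition tabloid_of :: "nat \<Rightarrow> (nat \<Rightarrow> nat \<times> nat) \<Rightarrow> (nat \<Rightarrow> nat) \<Rightarrow> nat list" where
  "tabloid_of n T s = map (\<lambda>k. fst (T (inv s k))) [0..<n]"

definition polytabloid :: "nat list \<Rightarrow> (nat \<Rightarrow> nat \<times> nat) \<Rightarrow> nat list \<Rightarrow> complex" where
  "polytabloid mu T = (\<lambda>f. \<Sum>s\<in>column_group (psize mu) T.
      of_int (sign s) * (if f = tabloid_of (psize mu) T s then 1 else 0))"

definition specht :: "nat list \<Rightarrow> (nat list \<Rightarrow> complex) set" where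
  "specht mu = module.span fscale (polytabloid mu ` tableaux mu)"

text \<open>Action of g on M^mu: g . {t} = {g t}.\<close>
definition act_M :: "nat \<Rightarrow> (nat \<Rightarrow> nat) \<Rightarrow> (nat list \<Rightarrow> complex) \<Rightarrow> (nat list \<Rightarrow> complex)" where
  "act_M n g F = (\<lambda>f. if length f = n then F (map (\<lambda>i. f ! g i) [0..<n]) else 0)"

text \<open>(C^n)^{tensor k} is the space of complex functions on words of length k over {0..<n}
  (the word w corresponds to e_{w_1} tensor ... tensor e_{w_k}).\<close>
definition words :: "nat \<Rightarrow> nat \<Rightarrow> nat list set" where
  "words n k = {w. length w = k \<and> set w \<subseteq> {..<n}}"

definition tensor_space :: "nat \<Rightarrow> nat \<Rightarrow> (nat list \<Rightarrow> complex) set" where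
  "tensor_space n k = {F. \<forall>w. w \<notin> words n k \<longrightarrow> F w = 0}"

text \<open>Position in {0..<k} of cell (i,j) in the canonical (row reading) tableau of shape la.\<close>
definition cpos :: "nat list \<Rightarrow> nat \<Rightarrow> nat \<Rightarrow> nat" where
  "cpos la i j = sum_list (take i la) + j"

definition row_group :: "nat list \<Rightarrow> (nat \<Rightarrow> nat) set" where
  "row_group la = {s. s permutes {..<psize la} \<and>
     (\<forall>(i, j)\<in>diagram la. \<exists>j'. (i, j') \<in> diagram la \<and> s (cpos la i j) = cpos la i j')}"

definition col_group :: "nat list \<Rightarrow> (nat \<Rightarrow> nat) set" where
  "col_group la = {s. s permutes {..<psize la} \<and>
     (\<forall>(i, j)\<in>diagram la. \<exists>i'. (i', j) \<in> diagram la \<and> s (cpos la i j) = cpos la i' j)}"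

definition pos_act :: "nat \<Rightarrow> nat \<Rightarrow> (nat \<Rightarrow> nat) \<Rightarrow> (nat list \<Rightarrow> complex) \<Rightarrow> (nat list \<Rightarrow> complex)" where
  "pos_act n k s F = (\<lambda>w. if w \<in> words n k then F (map (\<lambda>i. w ! s i) [0..<k]) else 0)"

definition young_sym :: "nat \<Rightarrow> nat list \<Rightarrow> (nat list \<Rightarrow> complex) \<Rightarrow> (nat list \<Rightarrow> complex)" where
  "young_sym n la F = (\<lambda>w. \<Sum>p\<in>row_group la. \<Sum>q\<in>col_group la.
      of_int (sign q) * pos_act n (psize la) p (pos_act n (psize la) q F) w)"

definition schur :: "nat list \<Rightarrow> nat \<Rightarrow> (nat list \<Rightarrow> complex) set" where
  "schur la n = young_sym n la ` tensor_space n (psize la)"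

text \<open>Action of g in S_n (as a permutation matrix in GL_n) on the tensor power.\<close>
definition act_T :: "nat \<Rightarrow> nat \<Rightarrow> (nat \<Rightarrow> nat) \<Rightarrow> (nat list \<Rightarrow> complex) \<Rightarrow> (nat list \<Rightarrow> complex)" where
  "act_T n k g F = (\<lambda>w. if w \<in> words n k then F (map (inv g) w) else 0)"

text \<open>S_n-equivariant linear maps V_mu -> S^la C^n (with n = |mu|), normalised to vanish
  outside V_mu so that they form a vector space isomorphic to Hom_{S_n}(V_mu, S^la C^n).\<close>
definition equiv_homs :: "nat list \<Rightarrow> nat list \<Rightarrow>
    ((nat list \<Rightarrow> complex) \<Rightarrow> (nat list \<Rightarrow> complex)) set" where
  "equiv_homs la mu = (let n = psize mu; V = specht mu; S = schur la n in
     {h. (\<forall>x. x \<notin> V \<longrightarrow> h x = 0) \<and> (\<forall>x\<in>V. h x \<in> S)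
       \<and> (\<forall>x\<in>V. \<forall>y\<in>V. h (x + y) = h x + h y)
       \<and> (\<forall>c. \<forall>x\<in>V. h (fscale c x) = fscale c (h x))
       \<and> (\<forall>g. g permutes {..<n} \<longrightarrow> (\<forall>x\<in>V. h (act_M n g x) = act_T n (psize la) g (h x)))})"

definition r_mult :: "nat list \<Rightarrow> nat list \<Rightarrow> nat" where
  "r_mult la mu = vector_space.dim mscale (equiv_homs la mu)"

end

(* Both the Specht module and the S_k-module generated by the Schur functor are permutation modules
   on words, and the Jucys-Murphy elements are self-adjoint on them, so all modules involved are
   spanned by joint eigenvectors.  Following Okounkov and Vershik, the eigenvalues along a joint
   eigenvector are the contents of a standard tableau whose shape is that of the module.

   Take a nonzero h : V_mu -> S^la(C^n) and a word w in the support of its image.  Say that w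
   contains m letters, b of which occur once, so that 2m <= b + k with k = |la|.  Number letters and
   positions so that the letters of w come first in {0..<n} and the b singletons occupy the positions
   given by their own values.  Evaluation at w does not distinguish S_b acting on letters from S_b
   acting on positions, so a joint eigenvector of S_n x S_k that does not vanish at w gives standard
   tableaux of shapes mu and la with the same first b boxes; call their set A.  As evaluation at w is
   invariant under the permutations of the unused letters, the eigenvector can be chosen so that the
   remaining n - m boxes of mu form a horizontal strip (Pieri).  The first m boxes then contain both A
   and mu-hat, so |A Int mu-hat| >= b + |mu-hat| - m >= 2|mu-hat| - k. *)
theory Submission
  imports "HOL-Computational_Algebra.Fundamental_Theorem_Algebra" Defs
begin

section \<open>Content sequences and standard tableaux\<close>

text \<open>Evaluation at one word \<open>w\<close> is a linear functional through which letter and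
  position permutations can be compared. It sees only part of the image of \<open>h\<close>, so
  every choice of a vector has to keep the value at \<open>w\<close> nonzero. Hence the letter
  weight is split off first, inside the Specht module, and pushed through \<open>h\<close> to a
  subspace stable under S_k; the position weight is split off inside that subspace. The two actions
  commute, so sorting the letter weight afterwards leaves the position weight alone. The commutation
  rules by themselves only make an eigenvalue sequence the contents of some standard tableau. That
  its shape is the given one comes from pairing row-invariant with column-alternating vectors, in
  both directions. The bound 2m <= b + k counts positions: every letter that is not a singleton
  takes at least two. The final estimate also uses |mu-hat| <= m, since b + |mu-hat| - m >= |mu-hat|
  + m - k.\<close>

lemma sort_by_adjacent_swaps:
  fixes key :: "'s \<Rightarrow> nat \<Rightarrow> int"
  assumes "P x"
    and step: "\<And>x i. P x \<Longrightarrow> m \<le> i \<Longrightarrow> Suc i < n \<Longrightarrow> key x (Suc i) < key x i \<Longrightarrow>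
      \<exists>x'. P x' \<and> key x' = key x \<circ> transpose i (Suc i)"
  shows "\<exists>x'. P x' \<and> (\<forall>i. m \<le> i \<longrightarrow> Suc i < n \<longrightarrow> key x' i \<le> key x' (Suc i))"
proof -
  define inv where "inv x = {(i, j). i < j \<and> j < n \<and> key x j < key x i}" for x
  have fin: "finite (inv x)" for x
    by (rule finite_subset[of _ "{..<n} \<times> {..<n}"]) (auto simp: inv_def)
  show ?thesis using \<open>P x\<close>
  proof (induction "card (inv x)" arbitrary: x rule: less_induct)
    case less
    show ?case
    proof (cases "\<forall>i. m \<le> i \<longrightarrow> Suc i < n \<longrightarrow> key x i \<le> key x (Suc i)")
      case True then show ?thesis using less.prems by blast
    next
      case False
      then obtain i where i: "m \<le> i" "Suc i < n" "key x (Suc i) < key x i" by force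
      from step[OF less.prems i] obtain x' where
        x': "P x'" "key x' = key x \<circ> transpose i (Suc i)" by blast
      let ?t = "transpose i (Suc i)"
      \<comment> \<open>The swap carries the inversions of the new sequence injectively into those
        of the old one and misses the pair at the descent, so their number drops.\<close>
      have "map_prod ?t ?t ` inv x' \<subseteq> inv x - {(i, Suc i)}"
      proof
        fix z assume "z \<in> map_prod ?t ?t ` inv x'"
        then obtain p q where pq: "z = (?t p, ?t q)" "p < q" "q < n"
          "key x (?t q) < key x (?t p)" by (auto simp: inv_def x')
        have ne: "\<not> (p = i \<and> q = Suc i)" using pq(4) i(3) by auto
        have 1: "?t p < ?t q" using pq(2) ne by (auto simp: transpose_def)
        have 2: "?t q < n" using pq(3) i(2) by (auto simp: transpose_def)
        have 3: "\<not> (?t p = i \<and> ?t q = Suc i)" using pq(2) by (auto simp: transpose_def split: if_splits)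
        show "z \<in> inv x - {(i, Suc i)}" using 1 2 3 pq by (auto simp: inv_def)
      qed
      then have "card (map_prod ?t ?t ` inv x') \<le> card (inv x - {(i, Suc i)})"
        using fin by (intro card_mono) auto
      also have "\<dots> < card (inv x)" using i fin by (intro card_Diff1_less) (auto simp: inv_def)
      also have "card (map_prod ?t ?t ` inv x') = card (inv x')"
        by (intro card_image inj_onI) (auto dest: transpose_eq_imp_eq)
      finally show ?thesis using less.hyps x'(1) by blast
    qed
  qed
qed

text \<open>\<open>Wt\<close> abstracts the set of joint eigenvalue sequences of the Jucys--Murphy elements on a
  module; only the values below \<open>n\<close> are meaningful.\<close>
locale content_system =
  fixes n :: nat and Wt :: "(nat \<Rightarrow> complex) \<Rightarrow> bool"
  assumes weight_0: "Wt a \<Longrightarrow> 0 < n \<Longrightarrow> a 0 = 0"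
    and weight_neq: "Wt a \<Longrightarrow> Suc i < n \<Longrightarrow> a i \<noteq> a (Suc i)"
    and weight_swap: "Wt a \<Longrightarrow> Suc i < n \<Longrightarrow> a (Suc i) \<noteq> a i + 1 \<Longrightarrow> a (Suc i) \<noteq> a i - 1 \<Longrightarrow>
      Wt (a \<circ> transpose i (Suc i))"
    and weight_no_aba: "Wt a \<Longrightarrow> Suc (Suc i) < n \<Longrightarrow> a (Suc (Suc i)) = a i \<Longrightarrow>
      a (Suc i) \<noteq> a i + 1 \<and> a (Suc i) \<noteq> a i - 1"
begin

text \<open>Each passed entry differs from the moved one by neither 1 nor -1, so every adjacent swap
  on the way is admissible.\<close>

lemma move_left:
  assumes "Wt a" "p \<le> q" "q < n"
    and "\<And>i. p \<le> i \<Longrightarrow> i < q \<Longrightarrow> a i \<noteq> a q + 1 \<and> a i \<noteq> a q - 1"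
  shows "\<exists>a'. Wt a' \<and> a' p = a q \<and> (\<forall>i. p \<le> i \<longrightarrow> i < q \<longrightarrow> a' (Suc i) = a i)
    \<and> (\<forall>i. i < p \<or> q < i \<longrightarrow> a' i = a i)"
  using assms(2,1,3,4)
proof (induction q arbitrary: a rule: dec_induct)
  case base then show ?case by (intro exI[of _ a]) auto
next
  case (step q)
  let ?b = "a \<circ> transpose q (Suc q)"
  have "a q \<noteq> a (Suc q) + 1 \<and> a q \<noteq> a (Suc q) - 1" using step.prems(3)[of q] step.hyps by simp
  then have "a (Suc q) \<noteq> a q + 1" "a (Suc q) \<noteq> a q - 1" by (metis add_diff_cancel_right' diff_add_cancel)+
  with step.prems have W: "Wt ?b" using weight_swap by blast
  have b: "?b i = a i" if "i < q" for i using that by (simp add: transpose_def)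
  have "\<exists>a'. Wt a' \<and> a' p = ?b q \<and> (\<forall>i. p \<le> i \<longrightarrow> i < q \<longrightarrow> a' (Suc i) = ?b i)
    \<and> (\<forall>i. i < p \<or> q < i \<longrightarrow> a' i = ?b i)"
  proof (rule step.IH[OF W])
    show "q < n" using step.prems by simp
    fix i assume "p \<le> i" "i < q"
    then show "?b i \<noteq> ?b q + 1 \<and> ?b i \<noteq> ?b q - 1" using step.prems(3)[of i] by (simp add: b)
  qed
  then obtain a' where a': "Wt a'" "a' p = ?b q" "\<forall>i. p \<le> i \<longrightarrow> i < q \<longrightarrow> a' (Suc i) = ?b i"
    "\<forall>i. i < p \<or> q < i \<longrightarrow> a' i = ?b i" by blast
  show ?case
  proof (intro exI[of _ a'] conjI allI impI)
    show "a' p = a (Suc q)" using a' by simp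
    fix i
    show "a' (Suc i) = a i" if "p \<le> i" "i < Suc q"
      using that a'(3,4) b by (cases "i = q") auto
    show "a' i = a i" if "i < p \<or> Suc q < i"
      using that a'(4) step.hyps by (auto simp: transpose_def)
  qed (use a' in blast)
qed

lemma move_right:
  assumes "Wt a" "p \<le> q" "q < n"
    and "\<And>i. p < i \<Longrightarrow> i \<le> q \<Longrightarrow> a i \<noteq> a p + 1 \<and> a i \<noteq> a p - 1"
  shows "\<exists>a'. Wt a' \<and> a' q = a p \<and> (\<forall>i. i < p \<or> q < i \<longrightarrow> a' i = a i)"
  using assms(2,1,3,4)
proof (induction q arbitrary: a rule: dec_induct)
  case base then show ?case by (intro exI[of _ a]) auto
next
  case (step q)
  from step.IH[of a] step.prems obtain b where b: "Wt b" "b q = a p"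
    "\<forall>i. i < p \<or> q < i \<longrightarrow> b i = a i" by auto
  have "b (Suc q) = a (Suc q)" using b by simp
  then have "Wt (b \<circ> transpose q (Suc q))"
    using weight_swap[OF b(1), of q] b(2) step.prems(2) step.prems(3)[of "Suc q"] step.hyps by simp
  moreover have "\<forall>i. i < p \<or> Suc q < i \<longrightarrow> (b \<circ> transpose q (Suc q)) i = a i"
    using b(3) step.hyps by (auto simp: transpose_def)
  moreover have "(b \<circ> transpose q (Suc q)) (Suc q) = a p" using b(2) by simp
  ultimately show ?case by blast
qed

text \<open>Otherwise the entry could travel to the front. There it is 0 by \<open>weight_0\<close>,
  and so is the old first entry, now next to it, against \<open>weight_neq\<close>.\<close>

lemma neighbour_before:
  assumes "Wt a" "0 < q" "q < n"
  shows "\<exists>i<q. a i = a q + 1 \<or> a i = a q - 1"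
proof (rule ccontr)
  assume "\<not> ?thesis"
  then obtain a' where a': "Wt a'" "a' 0 = a q" "\<forall>i. 0 \<le> i \<longrightarrow> i < q \<longrightarrow> a' (Suc i) = a i"
    using move_left[OF assms(1) _ assms(3), of 0] by auto
  have "a' 0 = 0" using weight_0[OF a'(1)] assms by simp
  moreover have "a' (Suc 0) = 0" using a'(3) weight_0[OF assms(1)] assms by simp
  ultimately show False using weight_neq[OF a'(1), of 0] assms by simp
qed

text \<open>For a shortest violation, admissible swaps bring the two equal entries either next to each other
  or into a pattern \<open>x, x \<plusminus> 1, x\<close>; both are excluded.\<close>
lemma neighbours_between:
  assumes "Wt a" "p < q" "q < n" "a p = a q" "e = 1 \<or> e = - 1"
  shows "\<exists>i. p < i \<and> i < q \<and> a i = a q + e"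
  using assms
proof (induction "q - p" arbitrary: a p q e rule: less_induct)
  case less
  note W = \<open>Wt a\<close>
  show ?case
  proof (cases "\<exists>r. p < r \<and> r < q \<and> a r = a q")
    case True
    then obtain r where r: "p < r" "r < q" "a r = a q" by blast
    with less.hyps[of r p a e] less.prems show ?thesis by fastforce
  next
    case False
    show ?thesis
    proof (rule ccontr)
      assume N: "\<not> ?thesis"
      show False
      proof (cases "\<exists>r. p < r \<and> r < q \<and> a r = a q - e")
        \<comment> \<open>With both neighbours absent, nothing stops the entry at \<open>q\<close>
          from moving right next to the equal entry at \<open>p\<close>.\<close>
        case no: False
        have "\<exists>a'. Wt a' \<and> a' (Suc p) = a q \<and> (\<forall>i. Suc p \<le> i \<longrightarrow> i < q \<longrightarrow> a' (Suc i) = a i)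
          \<and> (\<forall>i. i < Suc p \<or> q < i \<longrightarrow> a' i = a i)"
          using less.prems N no by (intro move_left) (auto simp: Suc_le_eq)
        then obtain a' where "Wt a'" "a' (Suc p) = a q" "a' p = a p" by auto
        then show False using weight_neq[of a' p] less.prems by auto
      next
        case True
        then obtain r where r: "p < r" "r < q" "a r = a q - e" by blast
        \<comment> \<open>Two opposite neighbours form a shorter pair of equal entries, which by
          induction encloses an entry equal to \<open>a q\<close>; that is excluded.\<close>
        have uniq: "i = r" if i: "p < i" "i < q" "a i = a q - e" for i
        proof (rule ccontr)
          assume "i \<noteq> r"
          have "\<exists>j. min i r < j \<and> j < max i r \<and> a j = a (max i r) + e"
          proof (rule less.hyps)
            show "max i r - min i r < q - p" "min i r < max i r" "max i r < n"
              using i r \<open>i \<noteq> r\<close> less.prems by (auto simp: max_def min_def)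
            show "a (min i r) = a (max i r)" using i r by (auto simp: max_def min_def)
          qed (use less.prems in auto)
          then obtain j where j: "min i r < j" "j < max i r" "a j = a (max i r) + e" by blast
          then have "p < j" "j < q" using i r by (auto simp: min_def max_def split: if_splits)
          moreover have "a (max i r) = a q - e" using i r by (auto simp: max_def)
          ultimately show False using False j(3) by auto
        qed
        \<comment> \<open>Only the obstacle \<open>r\<close> is left: the right copy moves to just
          behind it, then the left copy to just before it.\<close>
        have "\<exists>a'. Wt a' \<and> a' (Suc r) = a q \<and> (\<forall>i. Suc r \<le> i \<longrightarrow> i < q \<longrightarrow> a' (Suc i) = a i)
          \<and> (\<forall>i. i < Suc r \<or> q < i \<longrightarrow> a' i = a i)"
        proof (rule move_left)
          fix i assume "Suc r \<le> i" "i < q"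
          then show "a i \<noteq> a q + 1 \<and> a i \<noteq> a q - 1"
            using uniq[of i] N r less.prems by auto
        qed (use less.prems r in auto)
        then obtain b where b: "Wt b" "b (Suc r) = a q" "\<And>i. i \<le> r \<Longrightarrow> b i = a i" by auto
        have "\<exists>b'. Wt b' \<and> b' (r - 1) = b p \<and> (\<forall>i. i < p \<or> r - 1 < i \<longrightarrow> b' i = b i)"
        proof (rule move_right[OF b(1)])
          fix i assume i: "p < i" "i \<le> r - 1"
          have "i < r" "i < q" using i r by auto
          then have "a i \<noteq> a q + 1 \<and> a i \<noteq> a q - 1"
            using uniq[of i] N r i less.prems by auto
          then show "b i \<noteq> b p + 1 \<and> b i \<noteq> b p - 1" using i r b(3) less.prems(4) by auto
        qed (use less.prems r in auto)
        then obtain b' where b': "Wt b'" "b' (r - 1) = b p" "\<And>i. r - 1 < i \<Longrightarrow> b' i = b i" by auto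
        have "b' (r - 1) = a q" "b' (Suc (r - 1)) = a q - e" "b' (Suc (Suc (r - 1))) = a q"
          using b b' r less.prems by auto
        then show False using weight_no_aba[OF b'(1), of "r - 1"] less.prems r by auto
      qed
    qed
  qed
qed

lemma weight_Ints:
  assumes "Wt a" "q < n" shows "a q \<in> \<int>"
  using \<open>q < n\<close>
proof (induction q rule: less_induct)
  case (less q)
  show ?case
  proof (cases "q = 0")
    case True then show ?thesis using weight_0[OF \<open>Wt a\<close>] less.prems by auto
  next
    case False
    then obtain i where i: "i < q" "a i = a q + 1 \<or> a i = a q - 1"
      using neighbour_before[OF \<open>Wt a\<close>] less.prems by blast
    then have "a q = a i - 1 \<or> a q = a i + 1" by auto
    moreover have "a i \<in> \<int>" using i less by auto
    ultimately show ?thesis by auto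
  qed
qed

end

text \<open>The conditions by which Okounkov and Vershik characterise content sequences of standard
  tableaux. That such a sequence does come from a tableau is shown below.\<close>

locale content_sequence =
  fixes n :: nat and c :: "nat \<Rightarrow> int"
  assumes content_0: "0 < n \<Longrightarrow> c 0 = 0"
    and content_neighbour: "0 < q \<Longrightarrow> q < n \<Longrightarrow> \<exists>i<q. c i = c q + 1 \<or> c i = c q - 1"
    and content_between: "p < q \<Longrightarrow> q < n \<Longrightarrow> c p = c q \<Longrightarrow> e = 1 \<or> e = - 1 \<Longrightarrow>
      \<exists>i. p < i \<and> i < q \<and> c i = c q + e"

text \<open>The box added at step \<open>j\<close>: it lies on the diagonal of content \<open>c j\<close>, after the boxes
  that earlier steps have put there.\<close>
definition content_box :: "(nat \<Rightarrow> int) \<Rightarrow> nat \<Rightarrow> nat \<times> nat" where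
  "content_box c j = (card {i. i < j \<and> c i = c j} + nat (- c j), card {i. i < j \<and> c i = c j} + nat (c j))"

lemma content_box_content: "int (snd (content_box c j)) - int (fst (content_box c j)) = c j"
  by (simp add: content_box_def)

lemma content_box_uminus: "content_box (\<lambda>i. - c i) j = prod.swap (content_box c j)"
  by (simp add: content_box_def)

lemma content_box_cong: "(\<And>i. i \<le> j \<Longrightarrow> c i = c' i) \<Longrightarrow> content_box c j = content_box c' j"
proof -
  assume *: "\<And>i. i \<le> j \<Longrightarrow> c i = c' i"
  then have "{i. i < j \<and> c i = c j} = {i. i < j \<and> c' i = c' j}" by auto
  with * show ?thesis by (simp add: content_box_def)
qed

text \<open>A box depends only on the order of the steps within its own diagonal, and exchanging
  steps on different diagonals does not disturb that order.\<close>

lemma content_box_swap: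
  assumes "c i \<noteq> c (Suc i)"
  shows "content_box (c \<circ> transpose i (Suc i)) = content_box c \<circ> transpose i (Suc i)"
proof
  fix j
  let ?t = "transpose i (Suc i)"
  consider "j < i" | "j = i" | "j = Suc i" | "Suc i < j" by linarith
  then have "card {p. p < j \<and> c (?t p) = c (?t j)} = card {p. p < ?t j \<and> c p = c (?t j)}"
  proof cases
    case 1
    then have "{p. p < j \<and> c (?t p) = c (?t j)} = {p. p < ?t j \<and> c p = c (?t j)}"
      by (auto simp: transpose_def)
    then show ?thesis by simp
  next
    case 2
    then have "{p. p < j \<and> c (?t p) = c (?t j)} = {p. p < ?t j \<and> c p = c (?t j)}"
      using assms by (auto simp: transpose_def less_Suc_eq)
    then show ?thesis by simp
  next
    case 3
    then have "{p. p < j \<and> c (?t p) = c (?t j)} = {p. p < ?t j \<and> c p = c (?t j)}"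
      using assms by (auto simp: transpose_def less_Suc_eq)
    then show ?thesis by simp
  next
    case 4
    have "bij_betw ?t {p. p < j \<and> c (?t p) = c (?t j)} {p. p < j \<and> c p = c (?t j)}"
      by (rule bij_betwI[where g = ?t]) (use 4 in \<open>auto simp: transpose_def split: if_splits\<close>)
    moreover have "?t j = j" using 4 by (simp add: transpose_def)
    ultimately show ?thesis by (simp add: bij_betw_same_card)
  qed
  then show "content_box (c \<circ> ?t) j = (content_box c \<circ> ?t) j"
    by (simp add: content_box_def)
qed

text \<open>Order ideals of pairs (row, column), both counted from 0; the finite ones are the Young
  diagrams.\<close>

definition downset :: "(nat \<times> nat) set \<Rightarrow> bool" where
  "downset D \<longleftrightarrow> (\<forall>(i, j)\<in>D. \<forall>i'\<le>i. \<forall>j'\<le>j. (i', j') \<in> D)"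

lemma downsetD: "downset D \<Longrightarrow> (i, j) \<in> D \<Longrightarrow> i' \<le> i \<Longrightarrow> j' \<le> j \<Longrightarrow> (i', j') \<in> D"
  by (auto simp: downset_def)

lemma downset_if_predecessors:
  assumes u: "\<And>i j. (Suc i, j) \<in> D \<Longrightarrow> (i, j) \<in> D" and l: "\<And>i j. (i, Suc j) \<in> D \<Longrightarrow> (i, j) \<in> D"
  shows "downset D"
  unfolding downset_def
proof (clarify)
  fix i j i' j' assume d: "(i, j) \<in> D" "i' \<le> i" "j' \<le> j"
  have "(i', j) \<in> D" using d(2,1) by (induction i rule: dec_induct) (auto dest: u)
  with d(3) show "(i', j') \<in> D" by (induction j rule: dec_induct) (auto dest: l)
qed

lemma inj_content_box: "inj (content_box c)"
proof (rule injI)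
  have *: False if "i < j" "content_box c i = content_box c j" for i j
  proof -
    have c: "c i = c j" using that(2) content_box_content by metis
    have "{p. p < i \<and> c p = c i} \<subset> {p. p < j \<and> c p = c j}" using that(1) c by auto
    then have "card {p. p < i \<and> c p = c i} < card {p. p < j \<and> c p = c j}"
      by (intro psubset_card_mono) auto
    then show False using that(2) c by (simp add: content_box_def)
  qed
  fix i j assume "content_box c i = content_box c j"
  then show "i = j" using *[of i j] *[of j i] by (metis linorder_neqE_nat)
qed

text \<open>A diagonal is filled without gaps, starting from its box on the border, so its box of
  index \<open>d\<close> is present once the count exceeds \<open>d\<close>.\<close>

lemma content_box_occurs:
  "d < card {i. i < j \<and> c i = e} \<Longrightarrow> (d + nat (- e), d + nat e) \<in> content_box c ` {..<j}"
proof (induction j)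
  case (Suc j)
  show ?case
  proof (cases "d < card {i. i < j \<and> c i = e}")
    case True with Suc show ?thesis by (auto simp: lessThan_Suc)
  next
    case False
    have eq: "{i. i < Suc j \<and> c i = e} = (if c j = e then insert j {i. i < j \<and> c i = e} else {i. i < j \<and> c i = e})"
      by (auto simp: less_Suc_eq)
    with False Suc.prems have "c j = e" "d = card {i. i < j \<and> c i = e}"
      by (auto split: if_splits)
    then have "content_box c j = (d + nat (- e), d + nat e)" by (simp add: content_box_def)
    then show ?thesis by (metis imageI lessThan_iff lessI)
  qed
qed auto

context content_sequence
begin

text \<open>Transposition of the tableau: column statements about \<open>c\<close> become row
  statements about the negated sequence.\<close>

lemma uminus_content_sequence: "content_sequence n (\<lambda>i. - c i)"
proof
  fix q assume "0 < q" "q < n"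
  then show "\<exists>i<q. - c i = - c q + 1 \<or> - c i = - c q - 1" using content_neighbour[of q] by force
next
  fix p q and e :: int assume "p < q" "q < n" "- c p = - c q" "e = 1 \<or> e = - 1"
  then show "\<exists>i. p < i \<and> i < q \<and> - c i = - c q + e" using content_between[of p q "- e"] by force
qed (use content_0 in auto)

text \<open>If the earlier neighbour has content \<open>c q + 1\<close>, then by induction content
  \<open>c q\<close> occurs before it, and \<open>c q - 1\<close> before that.\<close>

lemma smaller_content_before:
  "q < n \<Longrightarrow> 0 < c q \<Longrightarrow> \<exists>i<q. c i = c q - 1"
proof (induction q rule: less_induct)
  case (less q)
  then have "0 < q" using content_0 by (metis gr0I less_irrefl)
  then obtain i where i: "i < q" "c i = c q + 1 \<or> c i = c q - 1" using content_neighbour less by blast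
  show ?case
  proof (cases "c i = c q - 1")
    case False
    with i less obtain j where j: "j < i" "c j = c q" by force
    with i less show ?thesis by (metis less_trans)
  qed (use i in auto)
qed

text \<open>The inequality expresses that the left neighbour of box \<open>q\<close>, if it exists,
  is already present. Induction goes along the previous step on the same diagonal: between the two
  steps there is one of content \<open>c q - 1\<close>, so the right side grows along with the
  left.\<close>

lemma card_smaller_content:
  "q < n \<Longrightarrow> card {i. i < q \<and> c i = c q} + (if 0 < c q then 1 else 0) \<le> card {i. i < q \<and> c i = c q - 1}"
proof (induction q rule: less_induct)
  case (less q)
  show ?case
  proof (cases "{i. i < q \<and> c i = c q} = {}")
    case True
    have "0 < card {i. i < q \<and> c i = c q - 1}" if "0 < c q"
      using smaller_content_before[OF less.prems that] by (auto simp: card_gt_0_iff)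
    moreover have "card {i. i < q \<and> c i = c q} = 0" using True by (metis card.empty)
    ultimately show ?thesis by (cases "0 < c q") (simp_all only: if_True if_False, simp_all)
  next
    case False
    define p where "p = Max {i. i < q \<and> c i = c q}"
    have p: "p < q" "c p = c q" using Max_in[OF _ False] unfolding p_def by auto
    have max: "i \<le> p" if "i < q" "c i = c q" for i using that unfolding p_def by (intro Max_ge) auto
    have "{i. i < q \<and> c i = c q} = insert p {i. i < p \<and> c i = c p}"
      using p max by (auto simp: order_less_le)
    then have 1: "card {i. i < q \<and> c i = c q} = Suc (card {i. i < p \<and> c i = c p})" by simp
    obtain r where r: "p < r" "r < q" "c r = c q - 1" using content_between[OF p(1) less.prems p(2), of "-1"] by auto
    have "insert r {i. i < p \<and> c i = c p - 1} \<subseteq> {i. i < q \<and> c i = c q - 1}" using r p by auto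
    then have "card (insert r {i. i < p \<and> c i = c p - 1}) \<le> card {i. i < q \<and> c i = c q - 1}"
      by (intro card_mono) auto
    then have "Suc (card {i. i < p \<and> c i = c p - 1}) \<le> card {i. i < q \<and> c i = c q - 1}"
      using r by simp
    with 1 less.IH[OF p(1)] p less.prems show ?thesis by simp
  qed
qed

lemma left_box_before:
  assumes "q < n" "content_box c q = (r, Suc s)"
  shows "(r, s) \<in> content_box c ` {..<q}"
proof -
  \<comment> \<open>The index of the left neighbour on its own diagonal. For
    \<open>c q \<le> 0\<close> that diagonal starts one row further down, which lowers the index by
    one.\<close>
  let ?d = "if 0 < c q then card {i. i < q \<and> c i = c q} else card {i. i < q \<and> c i = c q} - 1"
  have "?d < card {i. i < q \<and> c i = c q - 1}"
    using card_smaller_content[OF assms(1)] assms(2) by (auto simp: content_box_def)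
  from content_box_occurs[OF this] have
    "(?d + nat (- (c q - 1)), ?d + nat (c q - 1)) \<in> content_box c ` {..<q}" .
  moreover have "(?d + nat (- (c q - 1)), ?d + nat (c q - 1)) = (r, s)"
    using assms(2) by (auto simp: content_box_def nat_diff_distrib)
  ultimately show ?thesis by simp
qed

end

context content_sequence
begin

lemma upper_box_before:
  assumes "q < n" "content_box c q = (Suc r, s)"
  shows "(r, s) \<in> content_box c ` {..<q}"
proof -
  interpret u: content_sequence n "\<lambda>i. - c i" by (rule uminus_content_sequence)
  have "content_box (\<lambda>i. - c i) q = (s, Suc r)" using assms by (simp add: content_box_uminus)
  from u.left_box_before[OF assms(1) this] have "prod.swap (r, s) \<in> prod.swap ` content_box c ` {..<q}"
    by (simp add: image_image content_box_uminus)
  then show ?thesis by (metis inj_image_mem_iff inj_swap)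
qed

lemma downset_content_shape:
  assumes "q \<le> n" shows "downset (content_box c ` {..<q})"
proof (rule downset_if_predecessors)
  fix i j assume "(Suc i, j) \<in> content_box c ` {..<q}"
  then obtain p where "p < q" "content_box c p = (Suc i, j)" by auto
  with upper_box_before[of p] assms show "(i, j) \<in> content_box c ` {..<q}" by fastforce
next
  fix i j assume "(i, Suc j) \<in> content_box c ` {..<q}"
  then obtain p where "p < q" "content_box c p = (i, Suc j)" by auto
  with left_box_before[of p] assms show "(i, j) \<in> content_box c ` {..<q}" by fastforce
qed

text \<open>Standardness: the first \<open>q + 1\<close> boxes form a downset that contains box
  \<open>q\<close>, hence also box \<open>p\<close>, and boxes are not repeated.\<close>

lemma content_box_order:
  assumes "q < n" "p \<noteq> q" "fst (content_box c p) \<le> fst (content_box c q)"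
    "snd (content_box c p) \<le> snd (content_box c q)"
  shows "p < q"
proof -
  have "content_box c p \<in> content_box c ` {..<Suc q}"
    using downset_content_shape[of "Suc q"] assms
      downsetD[of _ "fst (content_box c q)" "snd (content_box c q)" "fst (content_box c p)" "snd (content_box c p)"]
    by (simp add: Suc_le_eq)
  then have "p < Suc q" using inj_content_box by (metis inj_image_mem_iff lessThan_iff)
  with assms(2) show ?thesis by simp
qed

text \<open>By standardness a step to a higher row has to go to the right as well, so the content
  grows by at least 2 and the swap is admissible.\<close>

lemma content_gap_if_row_descent:
  assumes "Suc i < n" "fst (content_box c (Suc i)) < fst (content_box c i)"
  shows "c i + 1 < c (Suc i)"
proof -
  have "\<not> snd (content_box c (Suc i)) \<le> snd (content_box c i)"
    using content_box_order[of i "Suc i"] assms by auto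
  then show ?thesis using assms content_box_content[of c i] content_box_content[of c "Suc i"] by linarith
qed

text \<open>The left neighbour of the later box precedes it and lies weakly to the right of box
  \<open>i\<close>; standardness forces it to be box \<open>i\<close>.\<close>

lemma content_Suc_if_same_row:
  assumes "Suc i < n" "fst (content_box c (Suc i)) = fst (content_box c i)"
  shows "c (Suc i) = c i + 1"
proof -
  obtain r s s' where b: "content_box c i = (r, s)" "content_box c (Suc i) = (r, s')"
    using assms by (metis prod.collapse)
  have "\<not> s' \<le> s" using content_box_order[of i "Suc i"] assms b by auto
  then obtain t where t: "s' = Suc t" "s \<le> t" by (metis not_less_eq_eq Suc_le_D Suc_le_mono)
  from left_box_before[of "Suc i" r t] obtain p where p: "p < Suc i" "content_box c p = (r, t)"
    using assms b t by force
  have "\<not> i < p" using p by simp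
  then have "p = i" using content_box_order[of p i] p b t assms by auto
  then show ?thesis using b p t content_box_content[of c i] content_box_content[of c "Suc i"] by simp
qed

end

lemma (in content_system) content_sequence_if_weight:
  assumes "Wt (\<lambda>i. of_int (c i))" shows "content_sequence n c"
proof
  show "c 0 = 0" if "0 < n" using weight_0[OF assms that] by simp
  show "\<exists>i<q. c i = c q + 1 \<or> c i = c q - 1" if q: "0 < q" "q < n" for q
  proof -
    obtain i where "i < q" "complex_of_int (c i) = of_int (c q) + 1 \<or> complex_of_int (c i) = of_int (c q) - 1"
      using neighbour_before[OF assms q] by blast
    then have "complex_of_int (c i) = of_int (c q + 1) \<or> complex_of_int (c i) = of_int (c q - 1)" by simp
    then show ?thesis using \<open>i < q\<close> of_int_eq_iff by metis
  qed
  show "\<exists>i. p < i \<and> i < q \<and> c i = c q + e" if "p < q" "q < n" "c p = c q" "e = 1 \<or> e = - 1" for p q e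
  proof -
    have "\<exists>i. p < i \<and> i < q \<and> complex_of_int (c i) = of_int (c q) + of_int e"
      using neighbours_between[OF assms that(1,2), of "of_int e"] that(3,4) by auto
    then show ?thesis by (metis of_int_add of_int_eq_iff)
  qed
qed

text \<open>Row descents are admissible swaps, so sorting ends at the tableau of the same shape that
  is filled row after row. Its eigenvectors will turn out to be invariant under row
  transpositions.\<close>

lemma (in content_system) row_sorted_weight:
  assumes "Wt (\<lambda>i. of_int (c i))"
  shows "\<exists>c'. Wt (\<lambda>i. of_int (c' i)) \<and> content_box c' ` {..<n} = content_box c ` {..<n} \<and>
    (\<forall>i. Suc i < n \<longrightarrow> fst (content_box c' i) \<le> fst (content_box c' (Suc i)))"
proof -
  define P where "P c' \<longleftrightarrow> Wt (\<lambda>i. of_int (c' i)) \<and> content_box c' ` {..<n} = content_box c ` {..<n}" for c'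
  have "\<exists>c'. P c' \<and> (\<forall>i. 0 \<le> i \<longrightarrow> Suc i < n \<longrightarrow> int (fst (content_box c' i)) \<le> int (fst (content_box c' (Suc i))))"
  proof (rule sort_by_adjacent_swaps[of P c])
    show "P c" using assms by (simp add: P_def)
    fix d i assume d: "P d" "Suc i < n" "int (fst (content_box d (Suc i))) < int (fst (content_box d i))"
    let ?t = "transpose i (Suc i)"
    interpret d: content_sequence n d using content_sequence_if_weight d by (simp add: P_def)
    have gap: "d i + 1 < d (Suc i)" using d.content_gap_if_row_descent[of i] d by simp
    have "complex_of_int (d (Suc i)) \<noteq> of_int (d i + 1)" "complex_of_int (d (Suc i)) \<noteq> of_int (d i - 1)"
      unfolding of_int_eq_iff using gap by linarith+
    then have "complex_of_int (d (Suc i)) \<noteq> of_int (d i) + 1" "complex_of_int (d (Suc i)) \<noteq> of_int (d i) - 1"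
      by simp_all
    then have "Wt ((\<lambda>i. of_int (d i)) \<circ> ?t)" using d weight_swap by (simp add: P_def)
    then have 1: "Wt (\<lambda>i. of_int ((d \<circ> ?t) i))" by (simp add: comp_def)
    have 2: "content_box (d \<circ> ?t) = content_box d \<circ> ?t" using gap by (intro content_box_swap) auto
    have "?t ` {..<n} = {..<n}" using d(2)
      by (intro permutes_image permutes_swap_id) auto
    then have "content_box (d \<circ> ?t) ` {..<n} = content_box d ` {..<n}"
      unfolding 2 by (metis image_comp)
    with 1 d(1) have "P (d \<circ> ?t)" by (simp add: P_def)
    with 2 show "\<exists>x'. P x' \<and> (\<lambda>i. int (fst (content_box x' i))) = (\<lambda>i. int (fst (content_box d i))) \<circ> ?t"
      by (intro exI[of _ "d \<circ> ?t"]) (auto simp: comp_def)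
  qed
  then show ?thesis by (auto simp: P_def)
qed

text \<open>On modules this corresponds to the twist by the sign character.\<close>

lemma (in content_system) uminus_content_system: "content_system n (\<lambda>a. Wt (\<lambda>i. - a i))"
proof
  fix a i assume W: "Wt (\<lambda>i. - a i)" and i: "Suc i < n"
  show "a i \<noteq> a (Suc i)" using weight_neq[OF W i] by simp
  assume *: "a (Suc i) \<noteq> a i + 1" "a (Suc i) \<noteq> a i - 1"
  have "Wt ((\<lambda>i. - a i) \<circ> transpose i (Suc i))"
    using * by (intro weight_swap[OF W i]) (auto simp: algebra_simps minus_equation_iff)
  then show "Wt (\<lambda>ia. - (a \<circ> transpose i (Suc i)) ia)" by (simp add: comp_def)
next
  fix a i assume W: "Wt (\<lambda>i. - a i)" and i: "Suc (Suc i) < n" and *: "a (Suc (Suc i)) = a i"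
  show "a (Suc i) \<noteq> a i + 1 \<and> a (Suc i) \<noteq> a i - 1" using weight_no_aba[OF W i] * by auto
qed (use weight_0 in fastforce)

lemma (in content_system) column_sorted_weight:
  assumes "Wt (\<lambda>i. of_int (c i))"
  shows "\<exists>c'. Wt (\<lambda>i. of_int (c' i)) \<and> content_box c' ` {..<n} = content_box c ` {..<n} \<and>
    (\<forall>i. Suc i < n \<longrightarrow> snd (content_box c' i) \<le> snd (content_box c' (Suc i)))"
proof -
  interpret u: content_system n "\<lambda>a. Wt (\<lambda>i. - a i)" by (rule uminus_content_system)
  have "Wt (\<lambda>i. - of_int (- c i))" using assms by simp
  from u.row_sorted_weight[OF this] obtain c' where c': "Wt (\<lambda>i. - of_int (c' i))"
    "content_box c' ` {..<n} = content_box (\<lambda>i. - c i) ` {..<n}"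
    "\<forall>i. Suc i < n \<longrightarrow> fst (content_box c' i) \<le> fst (content_box c' (Suc i))" by blast
  have "content_box (\<lambda>i. - c' i) ` {..<n} = prod.swap ` content_box c' ` {..<n}"
    by (simp add: content_box_uminus image_image)
  also have "\<dots> = content_box c ` {..<n}" by (simp add: c'(2) content_box_uminus image_image)
  finally show ?thesis using c' by (intro exI[of _ "\<lambda>i. - c' i"]) (auto simp: content_box_uminus)
qed

section \<open>Dominance order on diagrams\<close>

lemma dominance_of_transversal_tableaux:
  fixes n :: nat and D E :: "(nat \<times> nat) set"
  assumes S: "bij_betw S {..<n} D" and T: "bij_betw T {..<n} E" and E: "downset E"
    and tr: "\<And>p q. p < n \<Longrightarrow> q < n \<Longrightarrow> p \<noteq> q \<Longrightarrow> fst (S p) = fst (S q) \<Longrightarrow> snd (T p) \<noteq> snd (T q)"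
  shows "card {x \<in> D. fst x < r} \<le> card {x \<in> E. fst x < r}"
proof -
  have fE: "finite E" using bij_betw_finite[OF T] by (metis finite_lessThan)
  define A where "A = {p. p < n \<and> fst (S p) < r}"
  define C where "C = (\<lambda>p. snd (T p)) ` {..<n}"
  have cD: "card {x \<in> D. fst x < r} = card A"
  proof -
    have "bij_betw S A {x \<in> D. fst x < r}"
      using S unfolding A_def bij_betw_def by (auto intro: inj_on_subset)
    then show ?thesis by (simp add: bij_betw_same_card)
  qed
  \<comment> \<open>A column of \<open>T\<close> holds at most one entry from each of the first
    \<open>r\<close> rows of \<open>S\<close>, and at most as many entries as it has boxes. The
    smaller of the two bounds is the number of its boxes in the first \<open>r\<close> rows.\<close>
  have le: "card {p \<in> A. snd (T p) = k} \<le> card {x \<in> E. fst x < r \<and> snd x = k}" for k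
  proof -
    let ?Ak = "{p \<in> A. snd (T p) = k}"
    have fAk: "finite ?Ak" unfolding A_def by simp
    have 1: "card ?Ak \<le> r"
    proof -
      have "inj_on (\<lambda>p. fst (S p)) ?Ak" using tr unfolding A_def inj_on_def by blast
      then have "card ?Ak \<le> card {..<r}" by (rule card_inj_on_le) (auto simp: A_def)
      then show ?thesis by simp
    qed
    have 2: "card ?Ak \<le> card {x \<in> E. snd x = k}"
    proof -
      have "inj_on T ?Ak" using T by (auto simp: A_def bij_betw_def inj_on_def)
      moreover have "T ` ?Ak \<subseteq> {x \<in> E. snd x = k}" using T by (auto simp: A_def bij_betw_def)
      ultimately show ?thesis using fE by (intro card_inj_on_le) auto
    qed
    show ?thesis
    proof (cases "\<exists>x\<in>E. snd x = k \<and> r \<le> fst x")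
      case True
      then obtain i where "(i, k) \<in> E" "r \<le> i" by auto
      then have "(\<lambda>j. (j, k)) ` {..<r} \<subseteq> {x \<in> E. fst x < r \<and> snd x = k}" using downsetD[OF E] by auto
      then have "card ((\<lambda>j. (j, k)) ` {..<r}) \<le> card {x \<in> E. fst x < r \<and> snd x = k}"
        using fE by (intro card_mono) auto
      then show ?thesis using 1 by (simp add: card_image inj_on_def)
    next
      case False
      then have "{x \<in> E. fst x < r \<and> snd x = k} = {x \<in> E. snd x = k}" by auto
      then show ?thesis using 2 by simp
    qed
  qed
  have fC: "finite C" by (simp add: C_def)
  have "card A = card (\<Union>k\<in>C. {p \<in> A. snd (T p) = k})" by (rule arg_cong[of _ _ card]) (auto simp: C_def A_def)
  also have "\<dots> = (\<Sum>k\<in>C. card {p \<in> A. snd (T p) = k})" using fC by (intro card_UN_disjoint) (auto simp: A_def)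
  also have "\<dots> \<le> (\<Sum>k\<in>C. card {x \<in> E. fst x < r \<and> snd x = k})" by (intro sum_mono le)
  also have "\<dots> = card (\<Union>k\<in>C. {x \<in> E. fst x < r \<and> snd x = k})"
    using fC fE by (intro card_UN_disjoint[symmetric]) auto
  also have "\<dots> \<le> card {x \<in> E. fst x < r}" using fE by (intro card_mono) auto
  finally show ?thesis by (simp add: cD)
qed

lemma downset_subset_if_row_counts:
  assumes D: "downset D" "finite D" and E: "downset E" "finite E"
    and eq: "\<And>r. card {x \<in> D. fst x < r} = card {x \<in> E. fst x < r}"
  shows "D \<subseteq> E"
proof
  have row: "card {x \<in> F. fst x = r} = card {x \<in> F. fst x < Suc r} - card {x \<in> F. fst x < r}"
    if "finite F" for F :: "(nat \<times> nat) set" and r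
  proof -
    have "{x \<in> F. fst x = r} = {x \<in> F. fst x < Suc r} - {x \<in> F. fst x < r}" by auto
    then show ?thesis using that by (simp add: card_Diff_subset Collect_mono_iff)
  qed
  fix x assume x: "x \<in> D"
  obtain r s where rs: "x = (r, s)" by (cases x)
  show "x \<in> E"
  proof (rule ccontr)
    assume "x \<notin> E"
    then have "{y \<in> E. fst y = r} \<subseteq> Pair r ` {..<s}" using downsetD[OF E(1)] rs
      by (auto simp: image_iff) (metis le_refl not_le)
    then have "card {y \<in> E. fst y = r} \<le> card (Pair r ` {..<s})" by (intro card_mono) auto
    then have "card {y \<in> E. fst y = r} \<le> s" by (simp add: card_image inj_on_def)
    moreover have "Pair r ` {..s} \<subseteq> {y \<in> D. fst y = r}" using downsetD[OF D(1)] x rs by auto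
    then have "card (Pair r ` {..s}) \<le> card {y \<in> D. fst y = r}" using D by (intro card_mono) auto
    then have "Suc s \<le> card {y \<in> D. fst y = r}" by (simp add: card_image inj_on_def)
    moreover have "card {y \<in> D. fst y = r} = card {y \<in> E. fst y = r}" using row D E eq by simp
    ultimately show False by simp
  qed
qed

section \<open>Jucys--Murphy elements on permutation modules of words\<close>

declare plus_fun_apply [simp del] zero_fun_apply [simp del] times_fun_apply [simp del]
  one_fun_apply [simp del] minus_apply [simp del] uminus_apply [simp del]

interpretation fs: vector_space "fscale :: complex \<Rightarrow> ('a \<Rightarrow> complex) \<Rightarrow> 'a \<Rightarrow> complex"
  by unfold_locales (auto simp: fscale_def fun_eq_iff plus_fun_apply algebra_simps)

lemma fscale_apply: "fscale c F x = c * F x"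
  by (simp add: fscale_def)

lemmas fun_apply = plus_fun_apply zero_fun_apply fscale_apply minus_apply uminus_apply

lemma sum_fun_apply: "(\<Sum>i\<in>A. f i) x = (\<Sum>i\<in>A. f i x)"
  for f :: "'i \<Rightarrow> 'a \<Rightarrow> 'b::comm_monoid_add"
  by (induction A rule: infinite_finite_induct) (auto simp: fun_apply)

text \<open>Linearity of \<open>l\<close> is asked for on the span only, because one application
  passes through \<open>h\<close>, which is linear just on the Specht module.\<close>

lemma span_nonzero_witness:
  assumes "u \<in> fs.span S" "l u \<noteq> (0::complex)"
    and "l 0 = 0"
    and "\<And>c x y. x \<in> S \<Longrightarrow> y \<in> fs.span S \<Longrightarrow> l (fscale c x + y) = c * l x + l y"
  shows "\<exists>v\<in>S. l v \<noteq> 0"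
proof (rule ccontr)
  assume *: "\<not> ?thesis"
  have "u \<in> fs.span S \<and> l u = 0"
    using assms(1)
  proof (induction rule: fs.span_induct_alt)
    case base show ?case using assms(3) fs.span_zero by blast
  next
    case (step c x y)
    then have "l (fscale c x + y) = 0" using assms(4)[of x y c] * by auto
    with step show ?case by (simp add: fs.span_add fs.span_scale fs.span_base)
  qed
  with assms(2) show False by simp
qed

lemma subspace_tensor_space: "fs.subspace (tensor_space L n)"
  by (auto simp: fs.subspace_def tensor_space_def fun_apply)

lemma finite_words: "finite (words L n)"
  using finite_lists_length_eq[of "{..<L}" n] by (simp add: words_def conj_commute)

lemma tensor_space_eqI:
  "F \<in> tensor_space L n \<Longrightarrow> G \<in> tensor_space L n \<Longrightarrow> (\<And>w. w \<in> words L n \<Longrightarrow> F w = G w) \<Longrightarrow> F = G"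
  by (rule ext) (metis (mono_tags, lifting) mem_Collect_eq tensor_space_def)

lemma reindex_words:
  assumes "w \<in> words L n" "s permutes {..<n}"
  shows "map (\<lambda>i. w ! s i) [0..<n] \<in> words L n"
  using assms permutes_in_image[OF assms(2)] by (auto simp: words_def) (metis lessThan_iff nth_mem subsetD)

text \<open>Hermitian rather than bilinear, so that only the zero vector is orthogonal to
  itself.\<close>

definition ip :: "nat \<Rightarrow> nat \<Rightarrow> (nat list \<Rightarrow> complex) \<Rightarrow> (nat list \<Rightarrow> complex) \<Rightarrow> complex" where
  "ip L n F G = (\<Sum>w\<in>words L n. F w * cnj (G w))"

text \<open>Counted from 0: the element of index 0 is an empty sum, which makes the first content
  0.\<close>

definition jucys_murphy :: "nat \<Rightarrow> nat \<Rightarrow> nat \<Rightarrow> (nat list \<Rightarrow> complex) \<Rightarrow> nat list \<Rightarrow> complex" where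
  "jucys_murphy L n j F = (\<Sum>i<j. pos_act L n (transpose i j) F)"

context
  fixes L n :: nat
begin

private abbreviation (input) act where "act \<equiv> pos_act L n"
private abbreviation (input) inner (infix "\<bullet>" 70) where "F \<bullet> G \<equiv> ip L n F G"
private abbreviation (input) "TS \<equiv> tensor_space L n"
private abbreviation (input) "X \<equiv> jucys_murphy L n"

lemma act_tensor_space: "act s F \<in> TS"
  by (simp add: tensor_space_def pos_act_def)

lemma act_add: "act s (F + G) = act s F + act s G"
  and act_scale: "act s (fscale c F) = fscale c (act s F)"
  and act_0: "act s 0 = 0"
  and act_uminus: "act s (- F) = - act s F"
  by (auto simp: pos_act_def fun_eq_iff fun_apply)

lemma act_diff: "act s (F - G) = act s F - act s G"
  by (auto simp: pos_act_def fun_eq_iff fun_apply)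

lemma act_sum: "act s (\<Sum>i\<in>A. f i) = (\<Sum>i\<in>A. act s (f i))"
  by (induction A rule: infinite_finite_induct) (auto simp: act_add act_0)

lemma act_act:
  assumes "s permutes {..<n}" "t permutes {..<n}"
  shows "act s (act t F) = act (s \<circ> t) F"
proof
  fix w :: "nat list"
  have "map (\<lambda>i. map (\<lambda>i. w ! s i) [0..<n] ! t i) [0..<n] = map (\<lambda>i. w ! s (t i)) [0..<n]"
    using permutes_in_image[OF assms(2)] by auto
  then have "F (map (\<lambda>i. map (\<lambda>i. w ! s i) [0..<n] ! t i) [0..<n]) = F (map (\<lambda>i. w ! s (t i)) [0..<n])"
    by (rule arg_cong)
  then show "act s (act t F) w = act (s \<circ> t) F w"
    using reindex_words[OF _ assms(1), of w L] by (simp add: pos_act_def)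
qed

lemma act_id: "F \<in> TS \<Longrightarrow> act id F = F"
  by (rule tensor_space_eqI[OF act_tensor_space]) (auto simp: pos_act_def words_def map_nth)

lemma transpose_permutes: "i < n \<Longrightarrow> j < n \<Longrightarrow> transpose i j permutes {..<n}"
  by (simp add: permutes_swap_id)

lemma act_transpose_twice:
  "i < n \<Longrightarrow> j < n \<Longrightarrow> F \<in> TS \<Longrightarrow> act (transpose i j) (act (transpose i j) F) = F"
  by (simp add: act_act transpose_permutes act_id)

lemma ip_add_left: "(F + G) \<bullet> H = F \<bullet> H + G \<bullet> H"
  and ip_add_right: "H \<bullet> (F + G) = H \<bullet> F + H \<bullet> G"
  and ip_diff_left: "(F - G) \<bullet> H = F \<bullet> H - G \<bullet> H"
  and ip_diff_right: "H \<bullet> (F - G) = H \<bullet> F - H \<bullet> G"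
  and ip_scale_left: "fscale c F \<bullet> H = c * (F \<bullet> H)"
  and ip_scale_right: "H \<bullet> fscale c F = cnj c * (H \<bullet> F)"
  and ip_minus_right: "H \<bullet> (- F) = - (H \<bullet> F)"
  and ip_0_left: "0 \<bullet> H = 0"
  and ip_0_right: "H \<bullet> 0 = 0"
  by (simp_all add: ip_def fun_apply sum.distrib sum_subtractf sum_negf sum_distrib_left algebra_simps)

lemma ip_sum_left: "(\<Sum>i\<in>A. f i) \<bullet> H = (\<Sum>i\<in>A. f i \<bullet> H)"
  by (induction A rule: infinite_finite_induct) (auto simp: ip_add_left ip_0_left)

lemma ip_sum_right: "H \<bullet> (\<Sum>i\<in>A. f i) = (\<Sum>i\<in>A. H \<bullet> f i)"
  by (induction A rule: infinite_finite_induct) (auto simp: ip_add_right ip_0_right)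

lemma ip_self_eq_0:
  assumes "F \<in> TS" "F \<bullet> F = 0" shows "F = 0"
proof -
  have "F \<bullet> F = of_real (\<Sum>w\<in>words L n. (cmod (F w))\<^sup>2)"
    unfolding ip_def of_real_sum by (intro sum.cong refl) (rule complex_norm_square[symmetric])
  with assms(2) have "(\<Sum>w\<in>words L n. (cmod (F w))\<^sup>2) = 0" by (metis of_real_eq_0_iff)
  then have "\<forall>w\<in>words L n. (cmod (F w))\<^sup>2 = 0" by (subst (asm) sum_nonneg_eq_0_iff) (auto simp: finite_words)
  then show ?thesis using assms(1)
    by (intro tensor_space_eqI[of _ L n]) (auto simp: tensor_space_def fun_apply)
qed

lemma ip_act_act:
  assumes "s permutes {..<n}" shows "act s F \<bullet> act s G = F \<bullet> G"
proof -
  let ?r = "\<lambda>s w. map (\<lambda>i. w ! s i) [0..<n]"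
  have inv: "inv s permutes {..<n}" using assms by (rule permutes_inv)
  have rr: "?r s (?r t w) = w" if "w \<in> words L n" "s permutes {..<n}" "\<And>i. t (s i) = i" for s t w
    using that permutes_in_image[OF that(2)] by (auto simp: words_def intro!: nth_equalityI)
  have "bij_betw (?r s) (words L n) (words L n)"
    by (rule bij_betwI[where g = "?r (inv s)"])
      (use assms inv in \<open>auto intro!: reindex_words rr simp: permutes_inverses[OF assms]\<close>)
  then have "(\<Sum>w\<in>words L n. F (?r s w) * cnj (G (?r s w))) = F \<bullet> G"
    unfolding ip_def by (rule sum.reindex_bij_betw)
  then show ?thesis by (simp add: ip_def pos_act_def)
qed

text \<open>A transposition is unitary and its own inverse, hence self-adjoint; this is what makes
  the Jucys-Murphy elements self-adjoint.\<close>

lemma ip_transpose: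
  assumes "i < n" "j < n" "F \<in> TS" "G \<in> TS"
  shows "act (transpose i j) F \<bullet> G = F \<bullet> act (transpose i j) G"
  using ip_act_act[OF transpose_permutes[OF assms(1,2)], of "F" "act (transpose i j) G"] assms
  by (simp add: act_transpose_twice)

lemma jm_tensor_space: "X j F \<in> TS"
  unfolding jucys_murphy_def by (intro fs.subspace_sum subspace_tensor_space act_tensor_space)

lemma jm_add: "X j (F + G) = X j F + X j G"
  by (simp add: jucys_murphy_def act_add sum.distrib)

lemma jm_scale: "X j (fscale c F) = fscale c (X j F)"
  by (simp add: jucys_murphy_def act_scale fs.scale_sum_right)

lemma jm_0: "X j 0 = 0"
  by (simp add: jucys_murphy_def act_0)

lemma jm_diff: "X j (F - G) = X j F - X j G"
  by (simp add: jucys_murphy_def act_diff sum_subtractf)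

lemma jm_sum: "X j (\<Sum>i\<in>A. f i) = (\<Sum>i\<in>A. X j (f i))"
  by (induction A rule: infinite_finite_induct) (auto simp: jm_add jm_0)

lemma jm_selfadjoint:
  assumes "j < n" "F \<in> TS" "G \<in> TS" shows "X j F \<bullet> G = F \<bullet> X j G"
  unfolding jucys_murphy_def ip_sum_left ip_sum_right using assms by (intro sum.cong ip_transpose) auto

lemma act_jm_conj:
  assumes s: "s permutes {..<n}" and j: "j < n"
  shows "act s (X j F) = (\<Sum>i<j. act (transpose (s i) (s j)) (act s F))"
proof -
  have "act s (act (transpose i j) F) = act (transpose (s i) (s j)) (act s F)" if "i < j" for i
  proof -
    have "s \<circ> transpose i j = transpose (s i) (s j) \<circ> s"
      using transpose_comp_eq[of s "s i" "s j"] permutes_bij[OF s] by (simp add: permutes_inverses[OF s])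
    moreover have "s i < n" "s j < n" "i < n" using permutes_in_image[OF s] that j by auto
    ultimately show ?thesis using s j by (simp add: act_act transpose_permutes)
  qed
  then show ?thesis by (simp add: jucys_murphy_def act_sum)
qed

lemma act_jm_commute:
  assumes s: "s permutes {..<n}" and j: "j < n" and "s j = j" "s ` {..<j} = {..<j}"
  shows "act s (X j F) = X j (act s F)"
proof -
  have "bij_betw s {..<j} {..<j}" using assms(4) permutes_inj_on[OF s] by (simp add: bij_betw_def)
  then have "(\<Sum>i<j. act (transpose (s i) j) (act s F)) = (\<Sum>i<j. act (transpose i j) (act s F))"
    by (rule sum.reindex_bij_betw)
  then show ?thesis using act_jm_conj[OF s j] assms(3) by (simp add: jucys_murphy_def)
qed

text \<open>Every transposition in \<open>X i\<close> fixes \<open>j\<close> and permutes the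
  indices below \<open>j\<close>, so it only reorders the terms of \<open>X j\<close>.\<close>

lemma jm_commute:
  assumes "i < j" "j < n" shows "X i (X j F) = X j (X i F)"
proof -
  have "act (transpose p i) (X j F) = X j (act (transpose p i) F)" if "p < i" for p
    using that assms by (intro act_jm_commute transpose_permutes) (auto simp: transpose_image_eq)
  then show ?thesis by (simp add: jucys_murphy_def[of L n i] jm_sum)
qed

lemma act_simple_jm_commute:
  assumes "Suc i < n" "j < n" "j \<noteq> i" "j \<noteq> Suc i"
  shows "act (transpose i (Suc i)) (X j F) = X j (act (transpose i (Suc i)) F)"
proof (rule act_jm_commute)
  have "i \<in> {..<j} \<longleftrightarrow> Suc i \<in> {..<j}" using assms by auto
  then show "transpose i (Suc i) ` {..<j} = {..<j}" by (rule transpose_image_eq)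
qed (use assms transpose_permutes in auto)

text \<open>The relation of the degenerate affine Hecke algebra: conjugating \<open>X i\<close> by
  the simple transposition gives \<open>X (Suc i)\<close> without its last term, which is that
  transposition itself.\<close>

lemma act_simple_jm:
  assumes "Suc i < n" "F \<in> TS"
  shows "act (transpose i (Suc i)) (X i F) = X (Suc i) (act (transpose i (Suc i)) F) - F"
proof -
  let ?s = "transpose i (Suc i)"
  have "act ?s (X i F) = (\<Sum>p<i. act (transpose p (Suc i)) (act ?s F))"
    using assms by (simp add: act_jm_conj transpose_permutes)
  also have "\<dots> = X (Suc i) (act ?s F) - act ?s (act ?s F)" by (simp add: jucys_murphy_def)
  finally show ?thesis using assms by (simp add: act_transpose_twice)
qed

section \<open>Diagonalisation of commuting self-adjoint operators\<close>

definition poly_app :: "(('a \<Rightarrow> complex) \<Rightarrow> ('a \<Rightarrow> complex)) \<Rightarrow> complex poly \<Rightarrow> ('a \<Rightarrow> complex) \<Rightarrow> 'a \<Rightarrow> complex" where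
  "poly_app A p u = (\<Sum>i\<le>degree p. fscale (coeff p i) ((A ^^ i) u))"

lemma poly_app_bound:
  assumes "degree p \<le> N"
  shows "poly_app A p u = (\<Sum>i\<le>N. fscale (coeff p i) ((A ^^ i) u))"
  unfolding poly_app_def
  by (rule sum.mono_neutral_left) (use assms in \<open>auto simp: coeff_eq_0\<close>)

lemma poly_app_linear_factor:
  assumes add: "\<And>F G. A (F + G) = A F + A G" and scale: "\<And>c F. A (fscale c F) = fscale c (A F)"
  shows "poly_app A ([:- c, 1:] * q) u = poly_app A q (A u - fscale c u)"
proof -
  define N where "N = degree q"
  have pow_diff: "(A ^^ i) (A u - fscale c u) = (A ^^ Suc i) u - fscale c ((A ^^ i) u)" for i
  proof (induction i)
    case (Suc i)
    have "A (F - G) = A F - A G" for F G using add[of "F - G" G] by simp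
    with Suc scale show ?case by simp
  qed simp
  have deg: "degree ([:- c, 1:] * q) \<le> Suc N"
    using degree_mult_le[of "[:- c, 1:]" q] by (simp add: N_def)
  have c0: "coeff ([:- c, 1:] * q) 0 = - c * coeff q 0" by simp
  have cS: "coeff ([:- c, 1:] * q) (Suc i) = coeff q i - c * coeff q (Suc i)" for i by simp
  have z: "coeff q (Suc N) = 0" by (simp add: N_def coeff_eq_0)
  have "poly_app A ([:- c, 1:] * q) u w = poly_app A q (A u - fscale c u) w" for w
  proof -
    let ?f = "\<lambda>i. (A ^^ i) u w"
    have "poly_app A ([:- c, 1:] * q) u w = (\<Sum>i\<le>Suc N. coeff ([:- c, 1:] * q) i * ?f i)"
      unfolding poly_app_bound[OF deg] by (simp add: sum_fun_apply fun_apply del: mult_pCons_left)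
    also have "\<dots> = - c * coeff q 0 * ?f 0 + (\<Sum>i\<le>N. (coeff q i - c * coeff q (Suc i)) * ?f (Suc i))"
      by (simp only: sum.atMost_Suc_shift c0 cS)
    also have "\<dots> = (\<Sum>i\<le>N. coeff q i * ?f (Suc i)) - c * (\<Sum>i\<le>Suc N. coeff q i * ?f i)"
      by (simp add: sum.atMost_Suc_shift sum_subtractf sum_distrib_left algebra_simps del: sum.atMost_Suc)
    also have "\<dots> = (\<Sum>i\<le>N. coeff q i * (?f (Suc i) - c * ?f i))"
      using z by (simp add: sum_subtractf sum_distrib_left algebra_simps)
    also have "\<dots> = poly_app A q (A u - fscale c u) w"
      by (simp add: poly_app_def N_def[symmetric] sum_fun_apply fun_apply pow_diff del: funpow.simps)
    finally show ?thesis .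
  qed
  then show ?thesis by blast
qed

lemma tensor_space_span_indicators:
  assumes "F \<in> TS" shows "F \<in> fs.span ((\<lambda>w v. if v = w then 1 else 0) ` words L n)"
proof -
  have "F = (\<Sum>w\<in>words L n. fscale (F w) (\<lambda>v. if v = w then 1 else 0))"
  proof
    fix v
    show "F v = (\<Sum>w\<in>words L n. fscale (F w) (\<lambda>v. if v = w then 1 else 0)) v"
      using assms by (auto simp: sum_fun_apply fun_apply finite_words tensor_space_def if_distrib cong: if_cong)
  qed
  moreover have "(\<Sum>w\<in>words L n. fscale (F w) (\<lambda>v. if v = w then 1 else 0))
    \<in> fs.span ((\<lambda>w v. if v = w then 1 else 0) ` words L n)"
    by (intro fs.span_sum fs.span_scale fs.span_base imageI)
  ultimately show ?thesis by simp
qed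

lemma annihilating_poly:
  assumes A: "\<And>F. F \<in> TS \<Longrightarrow> A F \<in> TS" and u: "u \<in> TS"
  shows "\<exists>p. p \<noteq> 0 \<and> poly_app A p u = 0"
proof -
  define N where "N = card (words L n)"
  define v where "v i = (A ^^ i) u" for i
  have v: "v i \<in> TS" for i unfolding v_def using u A by (induction i) auto
  have "\<exists>f. (\<exists>i\<le>N. f i \<noteq> 0) \<and> (\<Sum>i\<le>N. fscale (f i) (v i)) = 0"
  \<comment> \<open>Linear dependence is a property of sets and does not see repetitions, so
    coinciding powers of \<open>A\<close> on \<open>u\<close> are treated apart.\<close>
  proof (cases "inj_on v {..N}")
    case False
    then obtain i j where ij: "i \<le> N" "j \<le> N" "i \<noteq> j" "v i = v j" by (auto simp: inj_on_def)
    define f where "f k = (if k = i then 1 else if k = j then -1 else 0 :: complex)" for k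
    have "(\<Sum>k\<le>N. fscale (f k) (v k)) = (\<Sum>k\<in>{i, j}. fscale (f k) (v k))"
      by (rule sum.mono_neutral_right) (use ij in \<open>auto simp: f_def\<close>)
    also have "\<dots> = 0" using ij by (auto simp: f_def fun_eq_iff fun_apply)
    finally show ?thesis using ij by (intro exI[of _ f]) (auto simp: f_def)
  next
    case True
    let ?B = "(\<lambda>w v. if v = w then 1 else 0 :: complex) ` words L n"
    have "card (v ` {..N}) = Suc N" using True by (simp add: card_image)
    moreover have "card ?B \<le> N" unfolding N_def by (intro card_image_le finite_words)
    ultimately have "\<not> card (v ` {..N}) \<le> card ?B" by simp
    moreover have "v ` {..N} \<subseteq> fs.span ?B" using tensor_space_span_indicators v by blast
    ultimately have "fs.dependent (v ` {..N})"
      using fs.independent_span_bound[of ?B "v ` {..N}"] finite_words by blast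
    then obtain g where g: "\<exists>x\<in>v ` {..N}. g x \<noteq> 0" "(\<Sum>x\<in>v ` {..N}. fscale (g x) x) = 0"
      by (subst (asm) fs.dependent_finite) auto
    have "(\<Sum>i\<le>N. fscale (g (v i)) (v i)) = 0" using g(2) True by (simp add: sum.reindex)
    with g(1) show ?thesis by (intro exI[of _ "\<lambda>i. g (v i)"]) auto
  qed
  then obtain f where f: "\<exists>i\<le>N. f i \<noteq> 0" "(\<Sum>i\<le>N. fscale (f i) (v i)) = 0" by blast
  define p where "p = (\<Sum>i\<le>N. monom (f i) i)"
  have cf: "coeff p i = (if i \<le> N then f i else 0)" for i
    by (simp add: p_def coeff_sum)
  have "degree p \<le> N" by (rule degree_le) (simp add: cf)
  then have "poly_app A p u = 0" using f(2) by (simp add: poly_app_bound cf v_def)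
  moreover have "p \<noteq> 0" using f(1) cf by (metis coeff_0)
  ultimately show ?thesis by blast
qed

text \<open>Induction on the degree of a polynomial annihilating \<open>u\<close>. Splitting off a
  root \<open>c\<close> puts \<open>A u - fscale c u\<close> into the span of the eigenvectors; it
  then has to be lifted back through \<open>A - c\<close>, and the only obstruction is a component
  of eigenvalue \<open>c\<close>.\<close>

lemma selfadjoint_diagonalizable:
  assumes W: "fs.subspace W" "W \<subseteq> TS"
    and add: "\<And>F G. A (F + G) = A F + A G" and scale: "\<And>c F. A (fscale c F) = fscale c (A F)"
    and AT: "\<And>F. F \<in> TS \<Longrightarrow> A F \<in> TS"
    and AW: "\<And>F. F \<in> W \<Longrightarrow> A F \<in> W"
    and sa: "\<And>F G. F \<in> TS \<Longrightarrow> G \<in> TS \<Longrightarrow> A F \<bullet> G = F \<bullet> A G"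
    and u: "u \<in> W"
  shows "u \<in> fs.span {v \<in> W. \<exists>c. A v = fscale c v}"
proof -
  let ?E = "{v \<in> W. \<exists>c. A v = fscale c v}"
  have A0: "A 0 = 0" using scale[of 0 0] by simp
  have diff: "A (F - G) = A F - A G" for F G using add[of "F - G" G] by simp
  have EW: "fs.span ?E \<subseteq> W" by (rule fs.span_minimal) (use W in auto)
  \<comment> \<open>On an eigenvector of eigenvalue \<open>d \<noteq> c\<close> the operator
    \<open>A - c\<close> is inverted by the factor \<open>1 / (d - c)\<close>; what belongs to
    \<open>c\<close> is collected in \<open>y0\<close>.\<close>
  have split: "\<exists>y0 z. y0 \<in> W \<and> A y0 = fscale c y0 \<and> z \<in> fs.span ?E \<and> y = y0 + (A z - fscale c z)"
    if "y \<in> fs.span ?E" for y c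
    using that
  proof (induction rule: fs.span_induct_alt)
    case base show ?case using W A0 fs.span_zero by (intro exI[of _ 0]) (auto simp: fs.subspace_0)
  next
    case (step k x y)
    then obtain y0 z where yz: "y0 \<in> W" "A y0 = fscale c y0" "z \<in> fs.span ?E" "y = y0 + (A z - fscale c z)"
      by blast
    from step obtain d where x: "x \<in> W" "A x = fscale d x" by blast
    show ?case
    proof (cases "d = c")
      case True
      show ?thesis
      proof (intro exI conjI)
        show "fscale k x + y0 \<in> W" using W x yz by (simp add: fs.subspace_add fs.subspace_scale)
        show "A (fscale k x + y0) = fscale c (fscale k x + y0)"
          using x yz True by (simp add: add scale fs.scale_right_distrib fs.scale_left_commute)
        show "z \<in> fs.span ?E" by fact
        show "fscale k x + y = fscale k x + y0 + (A z - fscale c z)" using yz by simp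
      qed
    next
      case False
      let ?z = "fscale (k / (d - c)) x + z"
      show ?thesis
      proof (intro exI conjI)
        show "y0 \<in> W" "A y0 = fscale c y0" by fact+
        have "x \<in> ?E" using x by blast
        then show "?z \<in> fs.span ?E" using yz(3) by (simp only: fs.span_add fs.span_scale fs.span_base)
        show "fscale k x + y = y0 + (A ?z - fscale c ?z)"
          using yz x False by (simp add: add scale fun_eq_iff fun_apply divide_simps) (simp add: algebra_simps)
      qed
    qed
  qed
  have main: "p \<noteq> 0 \<Longrightarrow> u \<in> W \<Longrightarrow> poly_app A p u = 0 \<Longrightarrow> u \<in> fs.span ?E" for p u
  proof (induction "degree p" arbitrary: p u)
    case 0
    then obtain k where "p = [:k:]" "k \<noteq> 0" by (metis degree_eq_zeroE pCons_0_0)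
    with 0 have "fscale k u = 0" by (simp add: poly_app_def)
    with \<open>k \<noteq> 0\<close> have "u = 0" by simp
    then show ?case by (simp add: fs.span_zero)
  next
    case (Suc d)
    have "\<not> constant (poly p)" using Suc.hyps(2) by (simp add: constant_degree)
    then obtain c where "poly p c = 0" using fundamental_theorem_of_algebra by blast
    then obtain q where q: "p = [:- c, 1:] * q" by (auto simp: poly_eq_0_iff_dvd)
    with Suc.prems have q0: "q \<noteq> 0" by auto
    have dq: "d = degree q" using Suc.hyps(2) q q0 degree_mult_eq[of "[:- c, 1:]" q] by simp
    let ?y = "A u - fscale c u"
    have yW: "?y \<in> W" using W Suc.prems AW by (simp add: fs.subspace_diff fs.subspace_scale)
    have "poly_app A q ?y = 0" using Suc.prems(3) unfolding q by (simp only: poly_app_linear_factor[OF add scale])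
    from Suc.hyps(1)[OF dq q0 yW this] have "?y \<in> fs.span ?E" .
    from split[OF this, of c] obtain y0 z where yz: "y0 \<in> W" "A y0 = fscale c y0" "z \<in> fs.span ?E"
      "?y = y0 + (A z - fscale c z)" by blast
    have zW: "z \<in> W" using yz EW by blast
    have y0: "y0 = A (u - z) - fscale c (u - z)"
      using yz(4) by (simp add: diff fs.scale_right_diff_distrib algebra_simps)
    have uz: "u - z \<in> W" using W Suc.prems zW by (simp add: fs.subspace_diff)
    have T: "y0 \<in> TS" "u - z \<in> TS" using yz uz W by auto
    \<comment> \<open>\<open>y0\<close> lies both in the kernel and in the image of
      \<open>A - c\<close>. If it were nonzero, \<open>c\<close> would be real and the two would be
      orthogonal.\<close>
    have "y0 = 0"
    proof (rule ccontr)
      assume ne: "y0 \<noteq> 0"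
      then have nz: "y0 \<bullet> y0 \<noteq> 0" using ip_self_eq_0 T by blast
      have "c * (y0 \<bullet> y0) = cnj c * (y0 \<bullet> y0)"
        using sa[OF T(1) T(1)] by (simp add: yz(2) ip_scale_left ip_scale_right)
      then have c: "cnj c = c" using nz by simp
      have "y0 \<bullet> y0 = A (u - z) \<bullet> y0 - c * ((u - z) \<bullet> y0)"
        by (subst (1) y0) (simp add: ip_diff_left ip_scale_left)
      also have "\<dots> = 0" using sa[OF T(2) T(1)] by (simp add: yz(2) ip_scale_right c)
      finally show False using nz by simp
    qed
    then have "A (u - z) = fscale c (u - z)" using y0 by simp
    then have "u - z \<in> fs.span ?E" using uz by (intro fs.span_base) blast
    from fs.span_add[OF this yz(3)] show ?case by simp
  qed
  obtain p where "p \<noteq> 0" "poly_app A p u = 0" using annihilating_poly[of A u] AT u W by blast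
  with main u show ?thesis by blast
qed

text \<open>The elements are diagonalised one at a time: \<open>X k\<close> commutes with its
  predecessors, so it preserves their joint eigenspaces in \<open>W\<close>.\<close>

lemma joint_diagonalizable:
  assumes W: "fs.subspace W" "W \<subseteq> TS" and XW: "\<And>j F. j < n \<Longrightarrow> F \<in> W \<Longrightarrow> X j F \<in> W" and u: "u \<in> W"
  shows "u \<in> fs.span {v \<in> W. \<exists>a. \<forall>j<n. X j v = fscale (a j) v}"
proof -
  define J where "J k = {v \<in> W. \<exists>a. \<forall>j<k. X j v = fscale (a j) v}" for k
  have "u \<in> fs.span (J k)" if "k \<le> n" for k
    using that
  proof (induction k)
    case 0 then show ?case using u by (intro fs.span_base) (auto simp: J_def)
  next
    case (Suc k)
    have "J k \<subseteq> fs.span (J (Suc k))"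
    proof
      fix v assume "v \<in> J k"
      then obtain a where v: "v \<in> W" "\<forall>j<k. X j v = fscale (a j) v" by (auto simp: J_def)
      define W' where "W' = {v \<in> W. \<forall>j<k. X j v = fscale (a j) v}"
      have "v \<in> fs.span {v \<in> W'. \<exists>c. X k v = fscale c v}"
      proof (rule selfadjoint_diagonalizable)
        show "fs.subspace W'" using W
          by (auto simp: fs.subspace_def W'_def jm_add jm_scale jm_0 fs.scale_right_distrib fs.scale_left_commute)
        show "X k F \<in> W'" if "F \<in> W'" for F
          using that XW[of k F] Suc.prems jm_commute[of _ k F] by (auto simp: W'_def jm_scale)
        show "v \<in> W'" using v by (simp add: W'_def)
      qed (use Suc.prems W in \<open>auto simp: W'_def jm_add jm_scale jm_tensor_space jm_selfadjoint\<close>)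
      moreover have "{v \<in> W'. \<exists>c. X k v = fscale c v} \<subseteq> J (Suc k)"
      proof
        fix v assume "v \<in> {v \<in> W'. \<exists>c. X k v = fscale c v}"
        then obtain c where "v \<in> W'" "X k v = fscale c v" by blast
        then show "v \<in> J (Suc k)"
          by (auto simp: J_def W'_def less_Suc_eq intro!: exI[of _ "a(k := c)"])
      qed
      ultimately show "v \<in> fs.span (J (Suc k))" using fs.span_mono by blast
    qed
    then have "fs.span (J k) \<subseteq> fs.span (J (Suc k))" by (simp add: fs.span_minimal)
    with Suc show ?case by auto
  qed
  from this[of n] show ?thesis by (simp add: J_def)
qed

lemma eigenvalue_real:
  assumes "j < n" "v \<in> TS" "v \<noteq> 0" "X j v = fscale a v" shows "cnj a = a"
proof -
  have "a * (v \<bullet> v) = cnj a * (v \<bullet> v)"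
    using jm_selfadjoint[OF assms(1,2,2)] by (simp add: assms(4) ip_scale_left ip_scale_right)
  then show ?thesis using ip_self_eq_0 assms by auto
qed

lemma eigenvectors_orthogonal:
  assumes "j < n" "v \<in> TS" "w \<in> TS" "X j v = fscale a v" "X j w = fscale b w" "a \<noteq> b"
  shows "v \<bullet> w = 0"
proof (cases "w = 0")
  case False
  have "a * (v \<bullet> w) = cnj b * (v \<bullet> w)"
    using jm_selfadjoint[OF assms(1-3)] by (simp add: assms ip_scale_left ip_scale_right)
  then show ?thesis using eigenvalue_real[OF assms(1,3) False assms(5)] assms(6) by auto
qed (simp add: ip_0_right)

section \<open>A simple transposition acting on a joint eigenvector\<close>

context
  fixes i :: nat and v :: "nat list \<Rightarrow> complex" and a b :: complex
  assumes i: "Suc i < n" and v: "v \<in> TS"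
    and Xi: "X i v = fscale a v" and Xi': "X (Suc i) v = fscale b v"
begin

private abbreviation (input) "s \<equiv> act (transpose i (Suc i))"

lemma jm_simple: "X i (s v) = fscale b (s v) - v" "X (Suc i) (s v) = fscale a (s v) + v"
proof -
  have i': "i < n" using i by simp
  have "s (X i (s v)) = X (Suc i) v - s v"
    using act_simple_jm[OF i act_tensor_space] i v by (simp add: act_transpose_twice)
  then have "s (s (X i (s v))) = s (fscale b v - s v)" by (simp add: Xi')
  then show "X i (s v) = fscale b (s v) - v"
    using i i' v by (simp add: act_transpose_twice jm_tensor_space act_diff act_scale)
  show "X (Suc i) (s v) = fscale a (s v) + v"
    using act_simple_jm[OF i v] by (simp add: Xi act_scale algebra_simps)
qed

text \<open>For equal eigenvalues \<open>v\<close> would be the image of \<open>s v\<close> under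
  \<open>a - X i\<close>, as in a Jordan block; self-adjointness then makes \<open>v\<close>
  orthogonal to itself.\<close>

lemma eigenvalues_distinct:
  assumes "v \<noteq> 0" shows "a \<noteq> b"
proof
  assume "a = b"
  have i': "i < n" using i by simp
  have "v = fscale a (s v) - X i (s v)" using jm_simple \<open>a = b\<close> by simp
  then have "v \<bullet> v = a * (s v \<bullet> v) - X i (s v) \<bullet> v" by (metis ip_diff_left ip_scale_left)
  also have "X i (s v) \<bullet> v = a * (s v \<bullet> v)"
    using jm_selfadjoint[OF i' act_tensor_space v] eigenvalue_real[OF i' v assms Xi]
    by (simp add: Xi ip_scale_right)
  finally have "v \<bullet> v = 0" by simp
  then show False using ip_self_eq_0 v assms by blast
qed

private abbreviation (input) "\<phi> \<equiv> s v - fscale (1 / (b - a)) v"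

text \<open>The intertwiner of Young's seminormal form: subtracting the right multiple of
  \<open>v\<close> from \<open>s v\<close> leaves a vector with the two eigenvalues
  exchanged.\<close>

lemma jm_intertwiner:
  assumes "a \<noteq> b" shows "X i \<phi> = fscale b \<phi>" "X (Suc i) \<phi> = fscale a \<phi>"
  using assms
  by (simp_all add: jm_diff jm_scale jm_simple Xi Xi' fun_eq_iff fun_apply divide_simps) (simp_all add: algebra_simps)

text \<open>The intertwined vector is orthogonal to \<open>v\<close>, having another eigenvalue.
  When the contents differ by 1 or -1 it is also an eigenvector of \<open>s\<close>, and moving
  \<open>s\<close> across the inner product shows that its norm is 0.\<close>

lemma act_simple_eigenvector:
  assumes "(b - a)\<^sup>2 = 1" shows "s v = fscale (b - a) v"
proof -
  have ab: "a \<noteq> b" using assms by auto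
  have inv: "1 / (b - a) = b - a" using assms ab by (simp add: field_simps power2_eq_square)
  have i': "i < n" using i by simp
  have \<phi>: "\<phi> \<in> TS" using subspace_tensor_space v act_tensor_space
    by (simp add: fs.subspace_diff fs.subspace_scale)
  have orth: "\<phi> \<bullet> v = 0" using eigenvectors_orthogonal[OF i' \<phi> v jm_intertwiner(1) Xi] ab by simp
  have s\<phi>: "s \<phi> = fscale (- (b - a)) \<phi>"
  proof
    fix x
    have 1: "s \<phi> = v - fscale (b - a) (s v)"
      using i i' v by (simp add: act_diff act_scale act_transpose_twice inv)
    have "s \<phi> x = (b - a)\<^sup>2 * v x - (b - a) * s v x" unfolding 1 assms by (simp add: fun_apply)
    also have "\<dots> = - (b - a) * (s v x - (b - a) * v x)" by (simp add: algebra_simps power2_eq_square)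
    finally show "s \<phi> x = fscale (- (b - a)) \<phi> x" unfolding inv by (simp add: fun_apply)
  qed
  have "\<phi> \<bullet> \<phi> = \<phi> \<bullet> s v" using orth by (simp add: ip_diff_right ip_scale_right)
  also have "\<dots> = s \<phi> \<bullet> v" using ip_transpose[OF i' i \<phi> v] by simp
  also have "\<dots> = 0" unfolding s\<phi> ip_scale_left orth by simp
  finally have "\<phi> = 0" using ip_self_eq_0 \<phi> by blast
  then show ?thesis using inv by simp
qed

text \<open>Otherwise \<open>s\<close> would scale \<open>v\<close> by \<open>1 / (b - a)\<close>,
  and since \<open>s\<close> is an involution this factor would have square 1.\<close>

lemma intertwiner_nonzero:
  assumes "v \<noteq> 0" "(b - a)\<^sup>2 \<noteq> 1" shows "\<phi> \<noteq> 0"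
proof
  assume "\<phi> = 0"
  then have sv: "s v = fscale (1 / (b - a)) v" by simp
  have ab: "a \<noteq> b" using eigenvalues_distinct assms by simp
  have "v = s (s v)" using i v by (simp add: act_transpose_twice)
  also have "\<dots> = fscale (1 / (b - a) * (1 / (b - a))) v" by (simp add: sv act_scale)
  finally have "fscale (1 / (b - a) * (1 / (b - a)) - 1) v = 0" by (simp add: fs.scale_left_diff_distrib)
  then have "1 / (b - a) * (1 / (b - a)) = 1" using assms by simp
  then show False using assms(2) ab by (simp add: field_simps power2_eq_square)
qed

end

end

section \<open>Weights of modules of a given shape\<close>

text \<open>Monotonicity makes indices of equal key an interval. A transposition inside it is a
  product of an odd number of adjacent ones, each acting by \<open>e\<close>, and
  \<open>e * e = 1\<close>.\<close>

lemma act_transpose_if_adjacent: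
  fixes key :: "nat \<Rightarrow> nat"
  assumes v: "v \<in> tensor_space L n" and e: "e * e = 1"
    and mono: "\<And>i. Suc i < n \<Longrightarrow> key i \<le> key (Suc i)"
    and adj: "\<And>i. Suc i < n \<Longrightarrow> key (Suc i) = key i \<Longrightarrow> pos_act L n (transpose i (Suc i)) v = fscale e v"
    and pq: "p < q" "q < n" "key p = key q"
  shows "pos_act L n (transpose p q) v = fscale e v"
proof -
  have le: "key i \<le> key j" if "i \<le> j" "j < n" for i j
    using that by (induction j rule: dec_induct) (auto intro: order_trans[OF _ mono])
  have "Suc p \<le> q" using pq by simp
  then show ?thesis using pq(2,3)
  proof (induction q rule: dec_induct)
    case base then show ?case using adj[of p] by simp
  next
    case (step q)
    have "key p \<le> key q" "key q \<le> key (Suc q)" using le[of p q] le[of q "Suc q"] step by auto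
    then have k: "key p = key q" "key (Suc q) = key q" using step.prems by auto
    have "transpose (Suc q) q \<circ> transpose q p \<circ> transpose (Suc q) q = transpose (Suc q) p"
      using step.hyps by (intro transpose_comp_triple) auto
    then have "transpose p (Suc q) = transpose q (Suc q) \<circ> (transpose p q \<circ> transpose q (Suc q))"
      by (simp add: transpose_commute comp_assoc)
    then have "pos_act L n (transpose p (Suc q)) v =
      pos_act L n (transpose q (Suc q)) (pos_act L n (transpose p q) (pos_act L n (transpose q (Suc q)) v))"
      using step by (simp add: act_act transpose_permutes permutes_compose)
    also have "\<dots> = fscale (e * e * e) v" using step k adj[of q] by (simp add: act_scale)
    finally show ?case using e by simp
  qed
qed

locale sym_module =
  fixes L n :: nat and W :: "(nat list \<Rightarrow> complex) set"
  assumes subspace: "fs.subspace W" and in_TS: "W \<subseteq> tensor_space L n"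
    and stable: "s permutes {..<n} \<Longrightarrow> v \<in> W \<Longrightarrow> pos_act L n s v \<in> W"
begin

definition weight_vec :: "(nat \<Rightarrow> complex) \<Rightarrow> (nat list \<Rightarrow> complex) \<Rightarrow> bool" where
  "weight_vec a v \<longleftrightarrow> v \<in> W \<and> (\<forall>j<n. jucys_murphy L n j v = fscale (a j) v)"

definition is_weight :: "(nat \<Rightarrow> complex) \<Rightarrow> bool" where
  "is_weight a \<longleftrightarrow> (\<exists>v. weight_vec a v \<and> v \<noteq> 0)"

lemma jm_stable: "j < n \<Longrightarrow> v \<in> W \<Longrightarrow> jucys_murphy L n j v \<in> W"
  unfolding jucys_murphy_def using subspace by (intro fs.subspace_sum stable transpose_permutes) auto

lemma span_weight_vecs: "u \<in> W \<Longrightarrow> u \<in> fs.span {v. \<exists>a. weight_vec a v}"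
  using joint_diagonalizable[OF subspace in_TS jm_stable, of u] by (simp add: weight_vec_def)

lemma weight_vec_simple:
  assumes "weight_vec a v" "Suc i < n" "(a (Suc i) - a i)\<^sup>2 = 1"
  shows "pos_act L n (transpose i (Suc i)) v = fscale (a (Suc i) - a i) v"
  using assms in_TS by (intro act_simple_eigenvector) (auto simp: weight_vec_def)

lemma weight_vec_intertwiner:
  assumes v: "weight_vec a v" and i: "Suc i < n" and ne: "a i \<noteq> a (Suc i)"
  shows "weight_vec (a \<circ> transpose i (Suc i))
    (pos_act L n (transpose i (Suc i)) v - fscale (1 / (a (Suc i) - a i)) v)" (is "weight_vec ?a ?w")
proof -
  have vW: "v \<in> W" and vT: "v \<in> tensor_space L n" and
    Xv: "\<And>j. j < n \<Longrightarrow> jucys_murphy L n j v = fscale (a j) v"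
    using v in_TS by (auto simp: weight_vec_def)
  have "?w \<in> W" using subspace vW i
    by (intro fs.subspace_diff fs.subspace_scale stable transpose_permutes) auto
  moreover have "jucys_murphy L n j ?w = fscale (?a j) ?w" if j: "j < n" for j
  proof (cases "j = i \<or> j = Suc i")
    case True
    then show ?thesis using jm_intertwiner[OF i vT Xv[of i] Xv[OF i] ne] i by auto
  next
    case False
    then have "jucys_murphy L n j (pos_act L n (transpose i (Suc i)) v)
      = pos_act L n (transpose i (Suc i)) (jucys_murphy L n j v)"
      using act_simple_jm_commute[OF i j] by simp
    then show ?thesis using False j
      by (simp add: jm_diff jm_scale Xv act_scale fs.scale_right_diff_distrib mult.commute)
  qed
  ultimately show ?thesis by (simp add: weight_vec_def)
qed

text \<open>Admissible swaps come from the intertwiner. In a pattern x, x + e, x the two simple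
  transpositions would act by \<open>e\<close> and \<open>- e\<close>, which contradicts the braid
  relation.\<close>

lemma content_system: "content_system n is_weight"
proof
  fix a assume "is_weight a" "0 < n"
  then obtain v where "jucys_murphy L n 0 v = fscale (a 0) v" "v \<noteq> 0" by (auto simp: is_weight_def weight_vec_def)
  then show "a 0 = 0" by (simp add: jucys_murphy_def)
next
  fix a i assume a: "is_weight a" and i: "Suc i < n"
  then obtain v where v: "weight_vec a v" "v \<noteq> 0" by (auto simp: is_weight_def)
  then have vv: "v \<in> tensor_space L n" "jucys_murphy L n i v = fscale (a i) v"
    "jucys_murphy L n (Suc i) v = fscale (a (Suc i)) v" using i in_TS by (auto simp: weight_vec_def)
  show ne: "a i \<noteq> a (Suc i)" using eigenvalues_distinct[OF i vv v(2)] .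
  assume "a (Suc i) \<noteq> a i + 1" "a (Suc i) \<noteq> a i - 1"
  then have "(a (Suc i) - a i)\<^sup>2 \<noteq> 1" by (auto simp: power2_eq_1_iff algebra_simps)
  from intertwiner_nonzero[OF i vv v(2) this] weight_vec_intertwiner[OF v(1) i ne]
  show "is_weight (a \<circ> transpose i (Suc i))" by (auto simp: is_weight_def)
next
  fix a i assume a: "is_weight a" and i: "Suc (Suc i) < n" and eq: "a (Suc (Suc i)) = a i"
  then obtain v where v: "weight_vec a v" "v \<noteq> 0" by (auto simp: is_weight_def)
  show "a (Suc i) \<noteq> a i + 1 \<and> a (Suc i) \<noteq> a i - 1"
  proof (rule ccontr)
    define e where "e = a (Suc i) - a i"
    assume "\<not> ?thesis"
    then have e: "e * e = 1" by (auto simp: e_def)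
    let ?s = "pos_act L n (transpose i (Suc i))" and ?t = "pos_act L n (transpose (Suc i) (Suc (Suc i)))"
    have s: "?s v = fscale e v" using weight_vec_simple[OF v(1), of i] i e by (simp add: e_def power2_eq_square)
    have t: "?t v = fscale (- e) v" using weight_vec_simple[OF v(1), of "Suc i"] i e eq
      by (simp add: e_def power2_eq_square algebra_simps)
    have "transpose i (Suc i) \<circ> transpose (Suc i) (Suc (Suc i)) \<circ> transpose i (Suc i) = transpose i (Suc (Suc i))"
      by (intro transpose_comp_triple) auto
    moreover have "transpose (Suc (Suc i)) (Suc i) \<circ> transpose (Suc i) i \<circ> transpose (Suc (Suc i)) (Suc i)
      = transpose (Suc (Suc i)) i"
      by (intro transpose_comp_triple) auto
    ultimately have "transpose i (Suc i) \<circ> (transpose (Suc i) (Suc (Suc i)) \<circ> transpose i (Suc i))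
      = transpose (Suc i) (Suc (Suc i)) \<circ> (transpose i (Suc i) \<circ> transpose (Suc i) (Suc (Suc i)))"
      by (simp add: transpose_commute comp_assoc)
    then have "?s (?t (?s v)) = ?t (?s (?t v))"
      using i by (simp add: act_act transpose_permutes permutes_compose)
    then have "fscale (- (e * e * e)) v = fscale (e * e * e) v" by (simp add: s t act_scale act_uminus mult.assoc)
    then have "fscale (2 * e) v = 0" using e by (simp add: fun_eq_iff fun_apply)
    then show False using v e by auto
  qed
qed

end

section \<open>Row-invariant and column-alternating vectors\<close>

definition row_invariant :: "nat \<Rightarrow> nat \<Rightarrow> (nat \<Rightarrow> nat \<times> nat) \<Rightarrow> (nat list \<Rightarrow> complex) \<Rightarrow> bool" where
  "row_invariant L n T v \<longleftrightarrow> v \<in> tensor_space L n \<and>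
     (\<forall>p<n. \<forall>q<n. fst (T p) = fst (T q) \<longrightarrow> pos_act L n (transpose p q) v = v)"

definition column_alternating :: "nat \<Rightarrow> nat \<Rightarrow> (nat \<Rightarrow> nat \<times> nat) \<Rightarrow> (nat list \<Rightarrow> complex) \<Rightarrow> bool" where
  "column_alternating L n T v \<longleftrightarrow> v \<in> tensor_space L n \<and>
     (\<forall>p<n. \<forall>q<n. p \<noteq> q \<longrightarrow> snd (T p) = snd (T q) \<longrightarrow> pos_act L n (transpose p q) v = - v)"

text \<open>A transposition inside a row of \<open>S\<close> and a column of \<open>T\<close> fixes
  \<open>v\<close>, negates \<open>w\<close> and preserves the inner product, which would have to
  vanish.\<close>

lemma row_invariant_column_alternating_transversal:
  assumes "row_invariant L n S v" "column_alternating L n T w" "ip L n v w \<noteq> 0"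
    "p < n" "q < n" "p \<noteq> q" "fst (S p) = fst (S q)"
  shows "snd (T p) \<noteq> snd (T q)"
proof
  assume "snd (T p) = snd (T q)"
  then have "ip L n v w = ip L n v (- w)"
    using ip_act_act[OF transpose_permutes[OF assms(4,5)], of L v w] assms
    by (simp add: row_invariant_def column_alternating_def)
  then show False using assms(3) by (simp add: ip_minus_right)
qed

lemma span_ip_nonzero:
  assumes "v \<in> tensor_space L n" "v \<noteq> 0" "v \<in> fs.span S"
  shows "\<exists>w\<in>S. ip L n w v \<noteq> 0" "\<exists>w\<in>S. ip L n v w \<noteq> 0"
proof -
  have nz: "ip L n v v \<noteq> 0" using ip_self_eq_0 assms by blast
  show "\<exists>w\<in>S. ip L n w v \<noteq> 0"
    by (rule span_nonzero_witness[OF assms(3), of "\<lambda>w. ip L n w v"]) (use nz in \<open>auto simp: ip_0_left ip_add_left ip_scale_left\<close>)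
  \<comment> \<open>The inner product is conjugate-linear in its second argument; its conjugate is
    the linear functional.\<close>
  have "\<exists>w\<in>S. cnj (ip L n v w) \<noteq> 0"
    by (rule span_nonzero_witness[OF assms(3), of "\<lambda>w. cnj (ip L n v w)"]) (use nz in \<open>auto simp: ip_0_right ip_add_right ip_scale_right\<close>)
  then show "\<exists>w\<in>S. ip L n v w \<noteq> 0" by simp
qed

text \<open>The two spanning conditions bound the shapes of the weights from both sides in the dominance
  order, which pins them down to \<open>D\<close> without any appeal to irreducibility.\<close>
locale shaped_module = sym_module +
  fixes D :: "(nat \<times> nat) set"
  assumes D: "downset D" "finite D"
    and span_row_invariant: "W \<subseteq> fs.span {v. \<exists>T. bij_betw T {..<n} D \<and> row_invariant L n T v}"
    and span_column_alternating: "W \<subseteq> fs.span {v. \<exists>T. bij_betw T {..<n} D \<and> column_alternating L n T v}"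
begin

text \<open>In a tableau filled row after row, consecutive steps in one row raise the content by 1,
  so the simple transposition acts trivially; the other row transpositions follow.\<close>

lemma row_invariant_weight_vec:
  assumes "content_sequence n c" "weight_vec (\<lambda>i. of_int (c i)) v"
    and "\<And>i. Suc i < n \<Longrightarrow> fst (content_box c i) \<le> fst (content_box c (Suc i))"
  shows "row_invariant L n (content_box c) v"
proof -
  interpret c: content_sequence n c by fact
  have v: "v \<in> tensor_space L n" using assms in_TS by (auto simp: weight_vec_def)
  have *: "pos_act L n (transpose p q) v = fscale 1 v"
    if "p < q" "q < n" "fst (content_box c p) = fst (content_box c q)" for p q
  proof (rule act_transpose_if_adjacent[OF v, where key = "\<lambda>i. fst (content_box c i)"])
    fix i assume i: "Suc i < n" "fst (content_box c (Suc i)) = fst (content_box c i)"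
    then have "c (Suc i) = c i + 1" by (rule c.content_Suc_if_same_row)
    then show "pos_act L n (transpose i (Suc i)) v = fscale 1 v"
      using weight_vec_simple[OF assms(2) i(1)] by simp
  qed (use assms(3) that in auto)
  have "pos_act L n (transpose p q) v = v"
    if "p < n" "q < n" "fst (content_box c p) = fst (content_box c q)" for p q
    using *[of p q] *[of q p] that v by (cases p q rule: linorder_cases) (auto simp: act_id transpose_commute)
  then show ?thesis using v by (simp add: row_invariant_def)
qed

lemma column_alternating_weight_vec:
  assumes "content_sequence n c" "weight_vec (\<lambda>i. of_int (c i)) v"
    and "\<And>i. Suc i < n \<Longrightarrow> snd (content_box c i) \<le> snd (content_box c (Suc i))"
  shows "column_alternating L n (content_box c) v"
proof -
  interpret c: content_sequence n c by fact
  interpret u: content_sequence n "\<lambda>i. - c i" by (rule c.uminus_content_sequence)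
  have v: "v \<in> tensor_space L n" using assms in_TS by (auto simp: weight_vec_def)
  have *: "pos_act L n (transpose p q) v = fscale (- 1) v"
    if "p < q" "q < n" "snd (content_box c p) = snd (content_box c q)" for p q
  proof (rule act_transpose_if_adjacent[OF v, where key = "\<lambda>i. snd (content_box c i)"])
    fix i assume i: "Suc i < n" "snd (content_box c (Suc i)) = snd (content_box c i)"
    then have "c (Suc i) = c i - 1" using u.content_Suc_if_same_row[of i] by (simp add: content_box_uminus)
    then show "pos_act L n (transpose i (Suc i)) v = fscale (- 1) v"
      using weight_vec_simple[OF assms(2) i(1)] by simp
  qed (use assms(3) that in auto)
  have "pos_act L n (transpose p q) v = - v"
    if "p < n" "q < n" "p \<noteq> q" "snd (content_box c p) = snd (content_box c q)" for p q
    using *[of p q] *[of q p] that v by (cases p q rule: linorder_cases) (auto simp: transpose_commute)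
  then show ?thesis using v by (simp add: column_alternating_def)
qed

theorem weight_shape:
  assumes "is_weight a"
  shows "\<exists>c. (\<forall>j<n. a j = of_int (c j)) \<and> content_sequence n c \<and> content_box c ` {..<n} = D"
proof -
  interpret w: content_system n is_weight by (rule content_system)
  define c where "c j = \<lfloor>Re (a j)\<rfloor>" for j
  have c: "a j = of_int (c j)" if "j < n" for j
    using w.weight_Ints[OF assms that] by (auto simp: c_def elim!: Ints_cases)
  have wc: "is_weight (\<lambda>i. of_int (c i))"
    using assms c by (auto simp: is_weight_def weight_vec_def)
  have cs: "content_sequence n c" by (rule w.content_sequence_if_weight[OF wc])
  let ?S = "content_box c ` {..<n}"
  have S: "downset ?S" "finite ?S" using content_sequence.downset_content_shape[OF cs, of n] by auto
  have bij: "bij_betw (content_box c') {..<n} ?S" if "content_box c' ` {..<n} = ?S" for c'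
    using that inj_on_subset[OF inj_content_box, of "{..<n}" c'] by (simp add: bij_betw_def)
  \<comment> \<open>The row-sorted eigenvector pairs nontrivially with some column-alternating
    generator of shape \<open>D\<close>, so \<open>D\<close> dominates the shape of the
    weight.\<close>
  have le: "card {x \<in> ?S. fst x < r} \<le> card {x \<in> D. fst x < r}" for r
  proof -
    obtain c' v where c': "is_weight (\<lambda>i. of_int (c' i))" "weight_vec (\<lambda>i. of_int (c' i)) v" "v \<noteq> 0"
      "content_box c' ` {..<n} = ?S" "\<forall>i. Suc i < n \<longrightarrow> fst (content_box c' i) \<le> fst (content_box c' (Suc i))"
      using w.row_sorted_weight[OF wc] by (auto simp: is_weight_def)
    have ri: "row_invariant L n (content_box c') v"
      using c' w.content_sequence_if_weight by (intro row_invariant_weight_vec) auto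
    have v: "v \<in> W" using c' by (simp add: weight_vec_def)
    obtain T w where
      T: "bij_betw T {..<n} D" "column_alternating L n T w" "ip L n v w \<noteq> 0"
      using span_ip_nonzero(2)[OF subsetD[OF in_TS v] c'(3) subsetD[OF span_column_alternating v]] by blast
    show ?thesis
      by (rule dominance_of_transversal_tableaux[OF bij[OF c'(4)] T(1) D(1)])
        (rule row_invariant_column_alternating_transversal[OF ri T(2,3)])
  qed
  \<comment> \<open>The reverse bound pairs the column-sorted eigenvector with a row-invariant
    generator of shape \<open>D\<close>.\<close>
  have ge: "card {x \<in> D. fst x < r} \<le> card {x \<in> ?S. fst x < r}" for r
  proof -
    obtain c' v where c': "is_weight (\<lambda>i. of_int (c' i))" "weight_vec (\<lambda>i. of_int (c' i)) v" "v \<noteq> 0"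
      "content_box c' ` {..<n} = ?S" "\<forall>i. Suc i < n \<longrightarrow> snd (content_box c' i) \<le> snd (content_box c' (Suc i))"
      using w.column_sorted_weight[OF wc] by (auto simp: is_weight_def)
    have ca: "column_alternating L n (content_box c') v"
      using c' w.content_sequence_if_weight by (intro column_alternating_weight_vec) auto
    have v: "v \<in> W" using c' by (simp add: weight_vec_def)
    obtain T w where
      T: "bij_betw T {..<n} D" "row_invariant L n T w" "ip L n w v \<noteq> 0"
      using span_ip_nonzero(1)[OF subsetD[OF in_TS v] c'(3) subsetD[OF span_row_invariant v]] by blast
    show ?thesis
      by (rule dominance_of_transversal_tableaux[OF T(1) bij[OF c'(4)] S(1)])
        (rule row_invariant_column_alternating_transversal[OF T(2) ca T(3)])
  qed
  have eq: "card {x \<in> ?S. fst x < r} = card {x \<in> D. fst x < r}" for r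
    by (rule le_antisym[OF le ge])
  have "?S = D"
    using downset_subset_if_row_counts[OF S D eq] downset_subset_if_row_counts[OF D S eq[symmetric]]
    by (rule subset_antisym)
  with c cs show ?thesis by (intro exI[of _ c]) simp
qed

end

section \<open>Specht modules and Schur functors\<close>

lemma diagram_Sigma: "diagram la = (SIGMA i:{..<length la}. {..<la ! i})"
  by (auto simp: diagram_def)

lemma finite_diagram: "finite (diagram la)"
  by (simp add: diagram_Sigma)

lemma card_diagram: "card (diagram la) = psize la"
  by (simp add: diagram_Sigma psize_def sum_list_sum_nth lessThan_atLeast0)

lemma downset_diagram:
  assumes "is_partition la" shows "downset (diagram la)"
proof -
  have "la ! i \<le> la ! i'" if "i' \<le> i" "i < length la" for i i'
    using that assms by (cases "i' = i") (auto simp: is_partition_def sorted_wrt_iff_nth_less)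
  then show ?thesis by (fastforce simp: downset_def diagram_def)
qed

lemma bij_betw_cpos: "bij_betw (\<lambda>(i, j). cpos la i j) (diagram la) {..<psize la}"
proof -
  have mono: "sum_list (take i la) \<le> sum_list (take i' la)" if "i \<le> i'" for i i'
  proof -
    have "take i' la = take i la @ take (i' - i) (drop i la)"
      using that by (metis le_add_diff_inverse take_add)
    then show ?thesis by simp
  qed
  have Suc: "cpos la i j < sum_list (take (Suc i) la)" if "(i, j) \<in> diagram la" for i j
    using that by (simp add: diagram_def cpos_def take_Suc_conv_app_nth)
  have lt: "cpos la i j < cpos la i' j'" if "(i, j) \<in> diagram la" "i < i'" for i j i' j'
    using Suc[OF that(1)] mono[of "Suc i" i'] that(2) by (simp add: cpos_def)
  have inj: "inj_on (\<lambda>(i, j). cpos la i j) (diagram la)"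
  proof (rule inj_onI, clarify)
    fix i j i' j' assume *: "(i, j) \<in> diagram la" "(i', j') \<in> diagram la" "cpos la i j = cpos la i' j'"
    then have "i = i'" using lt[of i j i' j'] lt[of i' j' i j] by (cases i i' rule: linorder_cases) auto
    with * show "i = i' \<and> j = j'" by (simp add: cpos_def)
  qed
  have "cpos la i j < psize la" if "(i, j) \<in> diagram la" for i j
    using Suc[OF that] mono[of "Suc i" "length la"] that by (simp add: psize_def diagram_def)
  then have "(\<lambda>(i, j). cpos la i j) ` diagram la \<subseteq> {..<psize la}" by auto
  then have "(\<lambda>(i, j). cpos la i j) ` diagram la = {..<psize la}"
    using inj by (intro card_subset_eq) (auto simp: card_image card_diagram)
  with inj show ?thesis by (simp add: bij_betw_def)
qed

definition canonical_tableau :: "nat list \<Rightarrow> nat \<Rightarrow> nat \<times> nat" where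
  "canonical_tableau la = inv_into (diagram la) (\<lambda>(i, j). cpos la i j)"

lemma bij_canonical_tableau: "bij_betw (canonical_tableau la) {..<psize la} (diagram la)"
  unfolding canonical_tableau_def by (rule bij_betw_inv_into[OF bij_betw_cpos])

lemma canonical_tableau_cpos: "(i, j) \<in> diagram la \<Longrightarrow> canonical_tableau la (cpos la i j) = (i, j)"
  unfolding canonical_tableau_def using bij_betw_inv_into_left[OF bij_betw_cpos, of "(i, j)"] by simp

lemma cpos_canonical_tableau:
  assumes "p < psize la"
  obtains i j where "(i, j) \<in> diagram la" "canonical_tableau la p = (i, j)" "cpos la i j = p"
proof -
  have "p \<in> (\<lambda>(i, j). cpos la i j) ` diagram la" using bij_betw_cpos assms by (simp add: bij_betw_def)
  then show ?thesis using that canonical_tableau_cpos by auto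
qed

text \<open>The Young subgroup preserving the level sets of \<open>c\<close>. With rows or columns
  of a tableau as levels it covers the groups used for polytabloids and for Young symmetrizers
  alike.\<close>

definition level_group :: "nat \<Rightarrow> (nat \<Rightarrow> nat) \<Rightarrow> (nat \<Rightarrow> nat) set" where
  "level_group n c = {s. s permutes {..<n} \<and> (\<forall>k<n. c (s k) = c k)}"

lemma cpos_less: "(i, j) \<in> diagram la \<Longrightarrow> cpos la i j < psize la"
  using bij_betw_cpos[of la] by (auto simp: bij_betw_def)

text \<open>Used with \<open>f = fst\<close> and \<open>f = snd\<close> to turn the description of
  row and column groups by cells into one by positions.\<close>

lemma cpos_preserved_iff:
  assumes s: "s permutes {..<psize la}"
  shows "(\<forall>(i, j)\<in>diagram la. \<exists>(i', j')\<in>diagram la. f (i', j') = f (i, j) \<and> s (cpos la i j) = cpos la i' j')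
    \<longleftrightarrow> (\<forall>p<psize la. f (canonical_tableau la (s p)) = f (canonical_tableau la p))" (is "?l \<longleftrightarrow> ?r")
proof
  assume ?l
  show ?r
  proof (intro allI impI)
    fix p assume "p < psize la"
    then obtain i j where "(i, j) \<in> diagram la" "canonical_tableau la p = (i, j)" "cpos la i j = p"
      by (rule cpos_canonical_tableau)
    with \<open>?l\<close> show "f (canonical_tableau la (s p)) = f (canonical_tableau la p)"
      using canonical_tableau_cpos by fastforce
  qed
next
  assume r: ?r
  show ?l
  proof clarify
    fix i j assume ij: "(i, j) \<in> diagram la"
    have "s (cpos la i j) < psize la" using permutes_in_image[OF s] cpos_less[OF ij] by simp
    then obtain i' j' where d: "(i', j') \<in> diagram la" "canonical_tableau la (s (cpos la i j)) = (i', j')"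
      "cpos la i' j' = s (cpos la i j)" by (rule cpos_canonical_tableau)
    with r[rule_format, OF cpos_less[OF ij]] canonical_tableau_cpos[OF ij]
    show "\<exists>(i', j')\<in>diagram la. f (i', j') = f (i, j) \<and> s (cpos la i j) = cpos la i' j'" by force
  qed
qed

lemma row_group_level_group: "row_group la = level_group (psize la) (\<lambda>p. fst (canonical_tableau la p))"
proof -
  have "(\<exists>(i', j')\<in>diagram la. fst (i', j') = fst (i, j) \<and> x = cpos la i' j')
    \<longleftrightarrow> (\<exists>j'. (i, j') \<in> diagram la \<and> x = cpos la i j')" for i j x by auto
  then show ?thesis
    unfolding row_group_def level_group_def
    by (intro Collect_cong conj_cong refl) (simp add: cpos_preserved_iff[where f = fst, symmetric])
qed

lemma col_group_level_group: "col_group la = level_group (psize la) (\<lambda>p. snd (canonical_tableau la p))"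
proof -
  have "(\<exists>(i', j')\<in>diagram la. snd (i', j') = snd (i, j) \<and> x = cpos la i' j')
    \<longleftrightarrow> (\<exists>i'. (i', j) \<in> diagram la \<and> x = cpos la i' j)" for i j x by auto
  then show ?thesis
    unfolding col_group_def level_group_def
    by (intro Collect_cong conj_cong refl) (simp add: cpos_preserved_iff[where f = snd, symmetric])
qed

lemma bij_level_group:
  assumes "p < n" "q < n" "c p = c q"
  shows "bij_betw (\<lambda>s. transpose p q \<circ> s) (level_group n c) (level_group n c)"
proof -
  have "transpose p q \<circ> s \<in> level_group n c" if "s \<in> level_group n c" for s
  proof -
    have "transpose p q \<circ> s permutes {..<n}"
      using that transpose_permutes[OF assms(1,2)] by (simp add: level_group_def permutes_compose)
    moreover have "c (transpose p q x) = c x" for x using assms(3) by (simp add: transpose_def)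
    ultimately show ?thesis using that by (simp add: level_group_def)
  qed
  then show ?thesis by (intro bij_betwI[where g = "\<lambda>s. transpose p q \<circ> s"]) (auto simp: comp_assoc[symmetric])
qed

lemma symmetrizer_invariant:
  assumes "p < n" "q < n" "c p = c q"
  shows "pos_act L n (transpose p q) (\<Sum>s\<in>level_group n c. pos_act L n s y) = (\<Sum>s\<in>level_group n c. pos_act L n s y)"
proof -
  have "pos_act L n (transpose p q) (\<Sum>s\<in>level_group n c. pos_act L n s y)
    = (\<Sum>s\<in>level_group n c. pos_act L n (transpose p q \<circ> s) y)"
    unfolding act_sum using assms
    by (intro sum.cong refl act_act transpose_permutes) (auto simp: level_group_def)
  also have "\<dots> = (\<Sum>s\<in>level_group n c. pos_act L n s y)"
    by (rule sum.reindex_bij_betw[OF bij_level_group[OF assms]])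
  finally show ?thesis .
qed

lemma antisymmetrizer_alternating:
  assumes "p < n" "q < n" "p \<noteq> q" "c p = c q"
  shows "pos_act L n (transpose p q) (\<Sum>s\<in>level_group n c. fscale (of_int (sign s)) (pos_act L n s y))
    = - (\<Sum>s\<in>level_group n c. fscale (of_int (sign s)) (pos_act L n s y))"
proof -
  have "pos_act L n (transpose p q) (\<Sum>s\<in>level_group n c. fscale (of_int (sign s)) (pos_act L n s y))
    = (\<Sum>s\<in>level_group n c. - fscale (of_int (sign (transpose p q \<circ> s))) (pos_act L n (transpose p q \<circ> s) y))"
    unfolding act_sum
  proof (intro sum.cong refl)
    fix s assume "s \<in> level_group n c"
    then have s: "s permutes {..<n}" by (simp add: level_group_def)
    have "permutation s" using s by (metis finite_lessThan permutation_permutes)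
    then have "sign (transpose p q \<circ> s) = - sign s"
      using assms(3) by (simp add: sign_compose permutation_swap_id sign_swap_id)
    then show "pos_act L n (transpose p q) (fscale (of_int (sign s)) (pos_act L n s y))
      = - fscale (of_int (sign (transpose p q \<circ> s))) (pos_act L n (transpose p q \<circ> s) y)"
      using assms s by (simp add: act_scale act_act transpose_permutes)
  qed
  also have "\<dots> = - (\<Sum>s\<in>level_group n c. fscale (of_int (sign s)) (pos_act L n s y))"
    unfolding sum_negf
    by (rule arg_cong[of _ _ uminus], rule sum.reindex_bij_betw[OF bij_level_group[OF assms(1,2,4)]])
  finally show ?thesis .
qed

lemma act_transpose_conj:
  assumes g: "g permutes {..<n}" and "p < n" "q < n"
  shows "pos_act L n (transpose p q) (pos_act L n g v) = pos_act L n g (pos_act L n (transpose (inv g p) (inv g q)) v)"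
proof -
  have "inv g p < n" "inv g q < n" using permutes_in_image[OF permutes_inv[OF g]] assms by auto
  then show ?thesis using assms transpose_comp_eq[OF permutes_bij[OF g], of p q]
    by (simp add: act_act transpose_permutes)
qed

lemma row_invariant_act:
  assumes "row_invariant L n T v" "g permutes {..<n}"
  shows "row_invariant L n (T \<circ> inv g) (pos_act L n g v)"
  using assms act_transpose_conj[OF assms(2)] permutes_in_image[OF permutes_inv[OF assms(2)]]
  by (simp add: row_invariant_def act_tensor_space)

lemma column_alternating_act:
  assumes "column_alternating L n T v" "g permutes {..<n}"
  shows "column_alternating L n (T \<circ> inv g) (pos_act L n g v)"
proof -
  have "inv g p \<noteq> inv g q" if "p \<noteq> q" for p q
    using that permutes_inj[OF permutes_inv[OF assms(2)]] by (auto dest: injD)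
  then show ?thesis
    using assms act_transpose_conj[OF assms(2)] permutes_in_image[OF permutes_inv[OF assms(2)]]
    by (simp add: column_alternating_def act_tensor_space act_uminus)
qed

lemma bij_betw_comp_inv:
  "bij_betw T {..<n} D \<Longrightarrow> g permutes {..<n} \<Longrightarrow> bij_betw (T \<circ> inv g) {..<n} D"
  by (rule bij_betw_trans[OF permutes_imp_bij[OF permutes_inv]])

text \<open>The tabloid of \<open>T\<close>, read as a word whose letters are row indices. This
  places the permutation module of tabloids inside a tensor power, where the results on words
  apply.\<close>

definition row_word :: "nat \<Rightarrow> (nat \<Rightarrow> nat \<times> nat) \<Rightarrow> nat list \<Rightarrow> complex" where
  "row_word n T = (\<lambda>f. if f = map (\<lambda>k. fst (T k)) [0..<n] then 1 else 0)"

section \<open>Specht modules as modules of words\<close>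

context
  fixes mu :: "nat list"
begin

private abbreviation (input) "n \<equiv> psize mu"
private abbreviation (input) "L \<equiv> length mu"

lemma tabloid_in_words:
  assumes "T \<in> tableaux mu" "s permutes {..<n}"
  shows "tabloid_of n T s \<in> words L n"
proof -
  have "fst (T (inv s k)) < L" if "k < n" for k
  proof -
    have "inv s k < n" using permutes_in_image[OF permutes_inv[OF assms(2)]] that by simp
    then have "T (inv s k) \<in> diagram mu" using assms(1) by (auto simp: tableaux_def bij_betw_def)
    then show ?thesis by (auto simp: diagram_def)
  qed
  then show ?thesis by (auto simp: tabloid_of_def words_def)
qed

lemma act_row_word:
  assumes "T \<in> tableaux mu" "s permutes {..<n}"
  shows "pos_act L n s (row_word n T) = (\<lambda>f. if f = tabloid_of n T s then 1 else 0)"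
proof
  fix f :: "nat list"
  have "map (\<lambda>i. f ! s i) [0..<n] = map (\<lambda>k. fst (T k)) [0..<n] \<longleftrightarrow> f = tabloid_of n T s"
    if "f \<in> words L n"
  proof -
    have "map (\<lambda>i. f ! s i) [0..<n] = map (\<lambda>k. fst (T k)) [0..<n] \<longleftrightarrow> (\<forall>i<n. f ! s i = fst (T i))" by auto
    also have "\<dots> \<longleftrightarrow> (\<forall>i<n. f ! i = fst (T (inv s i)))"
      using permutes_in_image[OF assms(2)] permutes_in_image[OF permutes_inv[OF assms(2)]]
        permutes_inverses[OF assms(2)] by (metis lessThan_iff)
    also have "\<dots> \<longleftrightarrow> f = tabloid_of n T s"
      using that by (auto simp: words_def tabloid_of_def intro!: nth_equalityI)
    finally show ?thesis .
  qed
  then show "pos_act L n s (row_word n T) f = (if f = tabloid_of n T s then 1 else 0)"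
    using tabloid_in_words[OF assms] by (auto simp: pos_act_def row_word_def)
qed

lemma row_word_eq:
  assumes "T \<in> tableaux mu"
  shows "row_word n T = (\<lambda>f. if f = tabloid_of n T id then 1 else 0)"
  by (simp add: row_word_def tabloid_of_def)

lemma row_word_tensor_space: "T \<in> tableaux mu \<Longrightarrow> row_word n T \<in> tensor_space L n"
  using tabloid_in_words[OF _ permutes_id] by (auto simp: row_word_eq tensor_space_def)

lemma row_invariant_row_word:
  assumes "T \<in> tableaux mu" shows "row_invariant L n T (row_word n T)"
proof -
  have "tabloid_of n T (transpose p q) = tabloid_of n T id" if "fst (T p) = fst (T q)" for p q
    using that by (auto simp: tabloid_of_def transpose_def)
  then show ?thesis using assms
    by (simp add: row_invariant_def row_word_tensor_space act_row_word transpose_permutes)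
      (simp add: row_word_eq)
qed

lemma row_word_comp_inv:
  assumes "T \<in> tableaux mu" "g permutes {..<n}"
  shows "row_word n (T \<circ> inv g) = pos_act L n g (row_word n T)"
  using assms by (simp add: act_row_word) (simp add: row_word_def tabloid_of_def)

lemma column_group_level_group: "column_group n T = level_group n (\<lambda>k. snd (T k))"
  by (simp add: column_group_def level_group_def)

lemma polytabloid_eq:
  assumes "T \<in> tableaux mu"
  shows "polytabloid mu T = (\<Sum>s\<in>level_group n (\<lambda>k. snd (T k)). fscale (of_int (sign s)) (pos_act L n s (row_word n T)))"
proof
  fix f
  show "polytabloid mu T f = (\<Sum>s\<in>level_group n (\<lambda>k. snd (T k)). fscale (of_int (sign s)) (pos_act L n s (row_word n T))) f"
    unfolding polytabloid_def sum_fun_apply fscale_apply column_group_level_group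
    by (intro sum.cong refl) (use assms in \<open>auto simp: act_row_word level_group_def\<close>)
qed

lemma act_polytabloid:
  assumes T: "T \<in> tableaux mu" and g: "g permutes {..<n}"
  shows "pos_act L n g (polytabloid mu T) = polytabloid mu (T \<circ> inv g)"
proof -
  let ?G = "level_group n (\<lambda>k. snd (T k))" and ?G' = "level_group n (\<lambda>k. snd ((T \<circ> inv g) k))"
  have T': "T \<circ> inv g \<in> tableaux mu" using T g by (simp add: tableaux_def bij_betw_comp_inv)
  have gi: "inv g permutes {..<n}" by (rule permutes_inv[OF g])
  have lt: "g k < n" "inv g k < n" if "k < n" for k
    using permutes_in_image[OF g] permutes_in_image[OF gi] that by auto
  have bij: "bij_betw (\<lambda>s. g \<circ> s \<circ> inv g) ?G ?G'"
  proof (rule bij_betwI[where g = "\<lambda>s. inv g \<circ> s \<circ> g"])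
    show "(\<lambda>s. g \<circ> s \<circ> inv g) \<in> ?G \<rightarrow> ?G'"
      using g gi lt by (auto simp: level_group_def permutes_compose permutes_inverses[OF g])
    show "(\<lambda>s. inv g \<circ> s \<circ> g) \<in> ?G' \<rightarrow> ?G"
    proof
      fix s assume s: "s \<in> ?G'"
      then have "snd (T (inv g (s (g k)))) = snd (T k)" if "k < n" for k
        using lt(1)[OF that] by (auto simp: level_group_def permutes_inverses[OF g])
      with s show "inv g \<circ> s \<circ> g \<in> ?G" using g gi by (simp add: level_group_def permutes_compose)
    qed
  qed (auto simp: fun_eq_iff permutes_inverses[OF g])
  have "polytabloid mu (T \<circ> inv g) = (\<Sum>s\<in>?G. fscale (of_int (sign (g \<circ> s \<circ> inv g)))
      (pos_act L n (g \<circ> s \<circ> inv g) (row_word n (T \<circ> inv g))))"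
    unfolding polytabloid_eq[OF T'] by (rule sum.reindex_bij_betw[OF bij, symmetric])
  also have "\<dots> = (\<Sum>s\<in>?G. pos_act L n g (fscale (of_int (sign s)) (pos_act L n s (row_word n T))))"
  proof (intro sum.cong refl)
    fix s assume "s \<in> ?G"
    then have s: "s permutes {..<n}" by (simp add: level_group_def)
    have perm: "permutation g" "permutation s" "permutation (inv g)" "permutation (g \<circ> s)"
      using s g gi permutes_compose[OF s g] finite_lessThan permutation_permutes by blast+
    have "sign (g \<circ> s \<circ> inv g) = sign s"
      using perm by (simp add: sign_compose sign_inverse sign_idempotent mult.left_commute)
    moreover have "g \<circ> s \<circ> inv g \<circ> g = g \<circ> s" by (simp add: comp_assoc permutes_inv_o[OF g])
    ultimately show "fscale (of_int (sign (g \<circ> s \<circ> inv g))) (pos_act L n (g \<circ> s \<circ> inv g) (row_word n (T \<circ> inv g)))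
      = pos_act L n g (fscale (of_int (sign s)) (pos_act L n s (row_word n T)))"
      using s g gi by (simp add: row_word_comp_inv[OF T g] act_scale act_act permutes_compose)
  qed
  finally show ?thesis by (simp add: polytabloid_eq[OF T] act_sum)
qed

lemma polytabloid_tensor_space: "T \<in> tableaux mu \<Longrightarrow> polytabloid mu T \<in> tensor_space L n"
  unfolding polytabloid_eq
  by (intro fs.subspace_sum fs.subspace_scale subspace_tensor_space act_tensor_space)

text \<open>A polytabloid is a signed sum of tabloids, each row-invariant for its own tableau, and
  as a whole it alternates on the columns of \<open>T\<close>.\<close>

lemma specht_shaped_module:
  assumes "is_partition mu"
  shows "shaped_module L n (specht mu) (diagram mu)"
proof
  show "fs.subspace (specht mu)" by (simp add: specht_def)
  show "specht mu \<subseteq> tensor_space L n" unfolding specht_def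
    by (intro fs.span_minimal subspace_tensor_space) (auto intro: polytabloid_tensor_space)
  show "pos_act L n s v \<in> specht mu" if s: "s permutes {..<n}" and v: "v \<in> specht mu" for s v
    using v unfolding specht_def
  proof (induction rule: fs.span_induct_alt)
    case base show ?case by (simp add: act_0 fs.span_zero)
  next
    case (step c x y)
    then obtain T where T: "T \<in> tableaux mu" "x = polytabloid mu T" by blast
    have "T \<circ> inv s \<in> tableaux mu" using T s by (simp add: tableaux_def bij_betw_comp_inv)
    then have "pos_act L n s x \<in> polytabloid mu ` tableaux mu" using T s by (simp add: act_polytabloid)
    with step show ?case by (simp only: act_add act_scale fs.span_add fs.span_scale fs.span_base)
  qed
  show "downset (diagram mu)" by (rule downset_diagram[OF assms])
  show "finite (diagram mu)" by (rule finite_diagram)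
  show "specht mu \<subseteq> fs.span {v. \<exists>T. bij_betw T {..<n} (diagram mu) \<and> row_invariant L n T v}"
    unfolding specht_def
  proof (intro fs.span_minimal fs.subspace_span, clarify)
    fix T assume T: "T \<in> tableaux mu"
    show "polytabloid mu T \<in> fs.span {v. \<exists>T. bij_betw T {..<n} (diagram mu) \<and> row_invariant L n T v}"
      unfolding polytabloid_eq[OF T]
    proof (intro fs.span_sum fs.span_scale fs.span_base CollectI exI conjI)
      fix s assume "s \<in> level_group n (\<lambda>k. snd (T k))"
      then have s: "s permutes {..<n}" by (simp add: level_group_def)
      show "bij_betw (T \<circ> inv s) {..<n} (diagram mu)" using T s by (simp add: tableaux_def bij_betw_comp_inv)
      show "row_invariant L n (T \<circ> inv s) (pos_act L n s (row_word n T))"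
        by (intro row_invariant_act row_invariant_row_word T s)
    qed
  qed
  show "specht mu \<subseteq> fs.span {v. \<exists>T. bij_betw T {..<n} (diagram mu) \<and> column_alternating L n T v}"
    unfolding specht_def
  proof (intro fs.span_mono subsetI CollectI, clarify)
    fix T assume T: "T \<in> tableaux mu"
    have "column_alternating L n T (polytabloid mu T)"
      unfolding column_alternating_def using polytabloid_tensor_space[OF T]
      by (auto simp: polytabloid_eq[OF T] intro: antisymmetrizer_alternating)
    then show "\<exists>T'. bij_betw T' {..<n} (diagram mu) \<and> column_alternating L n T' (polytabloid mu T)"
      using T by (auto simp: tableaux_def)
  qed
qed

lemma act_M_eq_pos_act:
  assumes "F \<in> tensor_space L n" "g permutes {..<n}"
  shows "act_M n g F = pos_act L n g F"
proof
  fix f :: "nat list"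
  have "set (map (\<lambda>i. f ! g i) [0..<n]) = set f" if "length f = n"
  proof -
    have "set (map (\<lambda>i. f ! g i) [0..<n]) = (\<lambda>i. f ! i) ` g ` {..<n}" by auto
    then show ?thesis using that permutes_image[OF assms(2)] by (auto simp: set_conv_nth)
  qed
  then show "act_M n g F f = pos_act L n g F f"
    using assms(1) by (auto simp: act_M_def pos_act_def words_def tensor_space_def)
qed

end

text \<open>The image of a Young symmetrizer need not be stable under permuting positions; its
  closure under S_k is the module to which the weight theory applies.\<close>

definition schur_module :: "nat list \<Rightarrow> nat \<Rightarrow> (nat list \<Rightarrow> complex) set" where
  "schur_module la n = fs.span {pos_act n (psize la) s F | s F. s permutes {..<psize la} \<and> F \<in> schur la n}"

lemma schur_shaped_module:
  assumes "is_partition la"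
  shows "shaped_module n (psize la) (schur_module la n) (diagram la)"
proof
  let ?k = "psize la" and ?T = "canonical_tableau la"
  let ?R = "level_group ?k (\<lambda>p. fst (?T p))" and ?C = "level_group ?k (\<lambda>p. snd (?T p))"
  let ?b = "\<lambda>G. \<Sum>q\<in>?C. fscale (of_int (sign q)) (pos_act n ?k q G)"
  let ?G = "{pos_act n ?k s F | s F. s permutes {..<?k} \<and> F \<in> schur la n}"
  have ys: "young_sym n la G = (\<Sum>p\<in>?R. pos_act n ?k p (?b G))" for G
    by (simp add: young_sym_def fun_eq_iff sum_fun_apply fscale_apply act_sum act_scale
        row_group_level_group col_group_level_group)
  have permR: "p permutes {..<?k}" if "p \<in> ?R" for p using that by (simp add: level_group_def)
  have T: "bij_betw ?T {..<?k} (diagram la)" by (rule bij_canonical_tableau)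
  show "fs.subspace (schur_module la n)" by (simp add: schur_module_def)
  show "schur_module la n \<subseteq> tensor_space n ?k" unfolding schur_module_def
    by (intro fs.span_minimal subspace_tensor_space) (auto intro: act_tensor_space)
  show "pos_act n ?k s v \<in> schur_module la n" if s: "s permutes {..<?k}" and v: "v \<in> schur_module la n" for s v
    using v unfolding schur_module_def
  proof (induction rule: fs.span_induct_alt)
    case base show ?case by (simp add: act_0 fs.span_zero)
  next
    case (step c x y)
    then obtain t F where t: "t permutes {..<?k}" "F \<in> schur la n" "x = pos_act n ?k t F" by blast
    then have "pos_act n ?k s x = pos_act n ?k (s \<circ> t) F" using s by (simp add: act_act)
    then have "pos_act n ?k s x \<in> ?G" using t permutes_compose[OF t(1) s] by blast
    with step show ?case by (simp only: act_add act_scale fs.span_add fs.span_scale fs.span_base)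
  qed
  show "downset (diagram la)" by (rule downset_diagram[OF assms])
  show "finite (diagram la)" by (rule finite_diagram)
  show "schur_module la n \<subseteq> fs.span {v. \<exists>T. bij_betw T {..<?k} (diagram la) \<and> row_invariant n ?k T v}"
    unfolding schur_module_def
  proof (intro fs.span_mono subsetI, clarify)
    fix s F assume s: "s permutes {..<?k}" and "F \<in> schur la n"
    then obtain G where F: "F = young_sym n la G" by (auto simp: schur_def)
    have "row_invariant n ?k ?T F"
      unfolding row_invariant_def F ys
      by (auto intro!: symmetrizer_invariant fs.subspace_sum subspace_tensor_space act_tensor_space)
    then show "\<exists>T. bij_betw T {..<?k} (diagram la) \<and> row_invariant n ?k T (pos_act n ?k s F)"
      using row_invariant_act s bij_betw_comp_inv[OF T] by blast
  qed
  show "schur_module la n \<subseteq> fs.span {v. \<exists>T. bij_betw T {..<?k} (diagram la) \<and> column_alternating n ?k T v}"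
    unfolding schur_module_def
  proof (intro fs.span_minimal fs.subspace_span, clarify)
    fix s F assume s: "s permutes {..<?k}" and "F \<in> schur la n"
    then obtain G where F: "F = young_sym n la G" by (auto simp: schur_def)
    \<comment> \<open>The column antisymmetrizer acts first, so \<open>F\<close> is a sum of
      translates of the alternating vector \<open>y\<close>, each alternating for a translated
      tableau.\<close>
    define y where "y = ?b G"
    have "column_alternating n ?k ?T (?b G)"
      unfolding column_alternating_def
      by (auto intro!: antisymmetrizer_alternating fs.subspace_sum fs.subspace_scale subspace_tensor_space act_tensor_space)
    then have y: "column_alternating n ?k ?T y" by (simp only: y_def)
    have mem: "pos_act n ?k s (pos_act n ?k p y)
        \<in> {v. \<exists>T. bij_betw T {..<?k} (diagram la) \<and> column_alternating n ?k T v}" if "p \<in> ?R" for p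
    proof (intro CollectI exI conjI)
      show "bij_betw (?T \<circ> inv p \<circ> inv s) {..<?k} (diagram la)"
        by (intro bij_betw_comp_inv T s permR[OF that])
      show "column_alternating n ?k (?T \<circ> inv p \<circ> inv s) (pos_act n ?k s (pos_act n ?k p y))"
        by (intro column_alternating_act y s permR[OF that])
    qed
    have "F = (\<Sum>p\<in>?R. pos_act n ?k p y)" unfolding F y_def by (rule ys)
    then have "pos_act n ?k s F = (\<Sum>p\<in>?R. pos_act n ?k s (pos_act n ?k p y))"
      by (simp only: act_sum)
    then show "pos_act n ?k s F \<in> fs.span {v. \<exists>T. bij_betw T {..<?k} (diagram la) \<and> column_alternating n ?k T v}"
      by (simp only: fs.span_sum[OF fs.span_base[OF mem]])
  qed
qed

section \<open>Normal form of a word\<close>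

lemma inj_on_extends_to_permutation:
  assumes "finite S" "A \<subseteq> S" "inj_on f A" "f ` A \<subseteq> S"
  shows "\<exists>g. g permutes S \<and> (\<forall>x\<in>A. g x = f x)"
proof -
  have "card (S - A) = card (S - f ` A)"
    using assms by (simp add: card_Diff_subset card_image finite_subset)
  then obtain h where h: "bij_betw h (S - A) (S - f ` A)"
    using finite_same_card_bij[of "S - A" "S - f ` A"] assms(1) by auto
  define g where "g x = (if x \<in> A then f x else if x \<in> S then h x else x)" for x
  have "bij_betw g A (f ` A)" using assms(3) by (simp add: bij_betw_def g_def inj_on_def image_def)
  moreover have "bij_betw g (S - A) (S - f ` A)" using h
    by (rule bij_betw_cong[THEN iffD1, rotated]) (simp add: g_def)
  ultimately have "bij_betw g (A \<union> (S - A)) (f ` A \<union> (S - f ` A))" by (rule bij_betw_combine) auto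
  then have "bij_betw g S S" using assms(2,4) by (simp add: Un_Diff_cancel Un_absorb1)
  then have "g permutes S" using assms(2) by (intro bij_imp_permutes) (auto simp: g_def)
  then show ?thesis by (auto simp: g_def)
qed

text \<open>\<open>s\<close> lists the positions of the singleton letters first, and
  \<open>g\<close> renumbers the letters: a singleton receives the number of its new position, the
  others follow up to \<open>m\<close>.\<close>

lemma word_normal_form:
  assumes w: "w \<in> words n k"
  obtains g s w0 m b where "g permutes {..<n}" "s permutes {..<k}" "w0 \<in> words n k"
    "map (inv g) (map (\<lambda>i. w0 ! inv s i) [0..<k]) = w"
    "set w0 = {..<m}" "\<forall>j<b. w0 ! j = j" "\<forall>i<k. \<forall>j<b. w0 ! i = j \<longrightarrow> i = j"
    "b \<le> m" "m \<le> n" "b \<le> k" "2 * m \<le> b + k"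
proof -
  have len: "length w = k" and sw: "set w \<subseteq> {..<n}" using w by (auto simp: words_def)
  \<comment> \<open>Positions whose letter occurs nowhere else.\<close>
  define B where "B = {i. i < k \<and> (\<forall>i'<k. w ! i' = w ! i \<longrightarrow> i' = i)}"
  define b where "b = card B"
  define m where "m = card (set w)"
  have B: "B \<subseteq> {..<k}" "finite B" by (auto simp: B_def)
  have bk: "b \<le> k" using card_mono[OF _ B(1)] by (simp add: b_def)
  have mn: "m \<le> n" using card_mono[OF _ sw] by (simp add: m_def)
  obtain f where f: "bij_betw f {..<b} B"
    using finite_same_card_bij[of "{..<b}" B] B by (auto simp: b_def)
  then obtain s where s: "s permutes {..<k}" "\<forall>j\<in>{..<b}. s j = f j"
    using inj_on_extends_to_permutation[of "{..<k}" "{..<b}" f] B bk by (auto simp: bij_betw_def)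
  have sB: "s j \<in> B" if "j < b" for j using s f that by (auto simp: bij_betw_def)
  have slt: "s i < k" if "i < k" for i using permutes_in_image[OF s(1)] that by simp
  define U where "U = (\<lambda>j. w ! s j) ` {..<b}"
  have injU: "inj_on (\<lambda>j. w ! s j) {..<b}"
  proof (rule inj_onI)
    fix j j' assume "j \<in> {..<b}" "j' \<in> {..<b}" "w ! s j = w ! s j'"
    then have "s j = s j'" using sB[of j] sB[of j'] by (auto simp: B_def)
    then show "j = j'" using permutes_inj[OF s(1)] by (auto dest: injD)
  qed
  have U: "U \<subseteq> set w" "card U = b"
    using slt bk len injU by (auto simp: U_def card_image)
  have bm: "b \<le> m" using card_mono[OF _ U(1)] U(2) by (simp add: m_def)
  define u where "u = inv_into {..<b} (\<lambda>j. w ! s j)"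
  have u: "bij_betw u U {..<b}" "\<And>j. j < b \<Longrightarrow> u (w ! s j) = j"
    using injU inv_into_f_f[OF injU] by (auto simp: u_def U_def bij_betw_inv_into bij_betw_imageI)
  have "card (set w - U) = card {b..<m}"
    using U by (simp add: card_Diff_subset finite_subset[OF U(1)] m_def)
  then obtain h where h: "bij_betw h (set w - U) {b..<m}"
    using finite_same_card_bij[of "set w - U" "{b..<m}"] by auto
  define g0 where "g0 l = (if l \<in> U then u l else h l)" for l
  have "bij_betw g0 U {..<b}" using u(1) by (rule bij_betw_cong[THEN iffD1, rotated]) (simp add: g0_def)
  moreover have "bij_betw g0 (set w - U) {b..<m}" using h
    by (rule bij_betw_cong[THEN iffD1, rotated]) (simp add: g0_def)
  ultimately have "bij_betw g0 (U \<union> (set w - U)) ({..<b} \<union> {b..<m})" by (rule bij_betw_combine) auto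
  moreover have "U \<union> (set w - U) = set w" "{..<b} \<union> {b..<m} = {..<m}" using U bm by auto
  ultimately have g0: "bij_betw g0 (set w) {..<m}" by simp
  then obtain g where g: "g permutes {..<n}" "\<forall>l\<in>set w. g l = g0 l"
    using inj_on_extends_to_permutation[of "{..<n}" "set w" g0] sw mn by (auto simp: bij_betw_def)
  define w0 where "w0 = map (\<lambda>i. g (w ! s i)) [0..<k]"
  have w0nth: "w0 ! i = g (w ! s i)" if "i < k" for i using that by (simp add: w0_def)
  have w0j: "w0 ! j = j" if "j < b" for j
  proof -
    have "w ! s j \<in> U" using that by (auto simp: U_def)
    then show ?thesis using that bk u(2)[OF that] g(2) U(1) by (auto simp: w0nth g0_def)
  qed
  have w0set: "set w0 = {..<m}"
  proof -
    have "set w0 = g ` (\<lambda>i. w ! i) ` s ` {..<k}" by (auto simp: w0_def)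
    also have "\<dots> = g ` set w" using permutes_image[OF s(1)] len by (simp add: nth_image lessThan_atLeast0)
    also have "\<dots> = {..<m}" using g(2) g0 by (auto simp: bij_betw_def)
    finally show ?thesis .
  qed
  show ?thesis
  proof (rule that[of g s w0 m b])
    show "w0 \<in> words n k" using w0set mn by (auto simp: words_def w0_def)
    show "map (inv g) (map (\<lambda>i. w0 ! inv s i) [0..<k]) = w"
      using permutes_in_image[OF permutes_inv[OF s(1)]] len
      by (intro nth_equalityI) (auto simp: w0nth permutes_inverses[OF s(1)] permutes_inverses[OF g(1)])
    have inj: "i = j" if "i < k" "j < b" "w0 ! i = j" for i j
    proof -
      have "g (w ! s i) = g (w ! s j)" using that w0j[of j] bk by (simp add: w0nth)
      then have "w ! s i = w ! s j" using permutes_inj[OF g(1)] by (auto dest: injD)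
      then have "s i = s j" using sB[OF that(2)] slt[OF that(1)] by (auto simp: B_def)
      then show ?thesis using permutes_inj[OF s(1)] by (auto dest: injD)
    qed
    then show "\<forall>i<k. \<forall>j<b. w0 ! i = j \<longrightarrow> i = j" by blast
    have fib: "(if l \<in> U then 1 else 2) \<le> card {i. i < k \<and> w ! i = l}" if l: "l \<in> set w" for l
    proof -
      obtain i where i: "i < k" "w ! i = l" using l len by (auto simp: in_set_conv_nth)
      show ?thesis
      proof (cases "l \<in> U")
        case True
        then show ?thesis using i by (auto simp: Suc_le_eq card_gt_0_iff)
      next
        case False
        have "i \<notin> B"
        proof
          assume "i \<in> B"
          then obtain j where "j < b" "i = f j" using f by (auto simp: bij_betw_def)
          then have "w ! i \<in> U" using s(2) by (auto simp: U_def)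
          with False i show False by simp
        qed
        then obtain i' where "i' < k" "w ! i' = l" "i' \<noteq> i" using i by (auto simp: B_def)
        then have "card {i, i'} \<le> card {i. i < k \<and> w ! i = l}" using i by (intro card_mono) auto
        then show ?thesis using False \<open>i' \<noteq> i\<close> by simp
      qed
    qed
    \<comment> \<open>Positions counted by letter: once for each of the \<open>b\<close> singletons,
      at least twice for each of the other \<open>m - b\<close> letters.\<close>
    have "2 * m - b = b + 2 * (m - b)" using bm by simp
    also have "\<dots> = (\<Sum>l\<in>U. 1) + (\<Sum>l\<in>set w - U. 2)"
      using U by (simp add: card_Diff_subset finite_subset[OF U(1)] m_def)
    also have "\<dots> = (\<Sum>l\<in>U. if l \<in> U then 1 else 2) + (\<Sum>l\<in>set w - U. if l \<in> U then 1 else 2)" by simp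
    also have "\<dots> = (\<Sum>l\<in>set w. if l \<in> U then 1 else 2)"
      using sum.subset_diff[OF U(1), of "\<lambda>l. if l \<in> U then 1 else 2 :: nat"] by simp
    also have "\<dots> \<le> (\<Sum>l\<in>set w. card {i. i < k \<and> w ! i = l})" by (intro sum_mono fib)
    also have "\<dots> = card (\<Union>l\<in>set w. {i. i < k \<and> w ! i = l})" by (intro card_UN_disjoint[symmetric]) auto
    also have "\<dots> \<le> card {..<k}" by (intro card_mono) auto
    finally show "2 * m \<le> b + k" by simp
  qed (use g s w0j w0set bm mn bk in auto)
qed

section \<open>Equivariant maps from a Specht module to a Schur functor\<close>

interpretation ms: vector_space "mscale :: complex \<Rightarrow> ('a \<Rightarrow> 'b \<Rightarrow> complex) \<Rightarrow> 'a \<Rightarrow> 'b \<Rightarrow> complex"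
  by unfold_locales (auto simp: mscale_def fun_eq_iff plus_fun_apply algebra_simps)

text \<open>Positive dimension is used only through its contrapositive: a set inside the span of the
  empty set has dimension 0.\<close>

lemma nonzero_hom_if_r_mult_pos:
  assumes "r_mult la mu > 0"
  obtains h u where "h \<in> equiv_homs la mu" "u \<in> specht mu" "h u \<noteq> 0"
proof -
  have "\<not> equiv_homs la mu \<subseteq> ms.span {}"
    using ms.dim_le_card[of "equiv_homs la mu" "{}"] assms by (auto simp: r_mult_def)
  then obtain h where h: "h \<in> equiv_homs la mu" "h \<noteq> 0" by auto
  then obtain u where "h u \<noteq> 0" by (auto simp: fun_eq_iff zero_fun_apply)
  moreover have "u \<in> specht mu" using h(1) \<open>h u \<noteq> 0\<close> by (auto simp: equiv_homs_def Let_def)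
  ultimately show ?thesis using that h by blast
qed

lemma map_inv_words: "w \<in> words n k \<Longrightarrow> g permutes {..<n} \<Longrightarrow> map g w \<in> words n k"
  using permutes_in_image[of g "{..<n}"] by (auto simp: words_def)

lemma act_T_add: "act_T n k g (F + G) = act_T n k g F + act_T n k g G"
  and act_T_scale: "act_T n k g (fscale c F) = fscale c (act_T n k g F)"
  and act_T_0: "act_T n k g 0 = 0"
  by (auto simp: act_T_def fun_eq_iff fun_apply)

text \<open>Renaming letters commutes with permuting positions, as in Schur-Weyl duality.\<close>

lemma act_T_pos_act:
  assumes "g permutes {..<n}" "s permutes {..<k}"
  shows "act_T n k g (pos_act n k s F) = pos_act n k s (act_T n k g F)"
proof
  fix w :: "nat list"
  have *: "map (\<lambda>i. map (inv g) w ! s i) [0..<k] = map (inv g) (map (\<lambda>i. w ! s i) [0..<k])" if "w \<in> words n k"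
    using that permutes_in_image[OF assms(2)] by (auto simp: words_def)
  have "F (map (\<lambda>i. map (inv g) w ! s i) [0..<k]) = F (map (inv g) (map (\<lambda>i. w ! s i) [0..<k]))"
    if "w \<in> words n k" using *[OF that] by (rule arg_cong)
  then show "act_T n k g (pos_act n k s F) w = pos_act n k s (act_T n k g F) w"
    using reindex_words[OF _ assms(2), of w n] map_inv_words[OF _ permutes_inv[OF assms(1)], of w k]
    by (simp add: act_T_def pos_act_def)
qed

lemma schur_tensor_space: "F \<in> schur la n \<Longrightarrow> F \<in> tensor_space n (psize la)"
  by (auto simp: schur_def young_sym_def pos_act_def tensor_space_def)

locale specht_hom =
  fixes la mu :: "nat list" and h :: "(nat list \<Rightarrow> complex) \<Rightarrow> nat list \<Rightarrow> complex"
  assumes la: "is_partition la" and mu: "is_partition mu" and h: "h \<in> equiv_homs la mu"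
begin

abbreviation (input) "n \<equiv> psize mu"
abbreviation (input) "k \<equiv> psize la"
abbreviation (input) "L \<equiv> length mu"

sublocale V: shaped_module L n "specht mu" "diagram mu"
  by (rule specht_shaped_module[OF mu])

sublocale N: shaped_module n k "schur_module la n" "diagram la"
  by (rule schur_shaped_module[OF la])

lemma h_schur: "u \<in> specht mu \<Longrightarrow> h u \<in> schur la n"
  and h_add: "u \<in> specht mu \<Longrightarrow> v \<in> specht mu \<Longrightarrow> h (u + v) = h u + h v"
  and h_scale: "u \<in> specht mu \<Longrightarrow> h (fscale c u) = fscale c (h u)"
  using h by (auto simp: equiv_homs_def Let_def)

lemma h_act:
  assumes "u \<in> specht mu" "g permutes {..<n}"
  shows "h (pos_act L n g u) = act_T n k g (h u)"
proof -
  have "h (act_M n g u) = act_T n k g (h u)" using assms h by (auto simp: equiv_homs_def Let_def)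
  then show ?thesis using act_M_eq_pos_act[of u mu g] V.in_TS assms by auto
qed

lemma h_0: "h 0 = 0"
  using h_scale[of 0 0] V.subspace by (simp add: fs.subspace_0)

lemma h_uminus: "u \<in> specht mu \<Longrightarrow> h (- u) = - h u"
  using h_scale[of u "- 1"] by simp

lemma h_diff: "u \<in> specht mu \<Longrightarrow> v \<in> specht mu \<Longrightarrow> h (u - v) = h u - h v"
  using h_add[of u "- v"] V.subspace by (simp add: h_uminus fs.subspace_neg)

lemma h_sum: "(\<And>i. i \<in> A \<Longrightarrow> f i \<in> specht mu) \<Longrightarrow> h (\<Sum>i\<in>A. f i) = (\<Sum>i\<in>A. h (f i))"
  by (induction A rule: infinite_finite_induct) (auto simp: h_0 h_add V.subspace fs.subspace_sum)

text \<open>The part of weight \<open>y\<close> for the letters in the module over both symmetric groups that is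
  generated by the image of \<open>h\<close>.\<close>
definition isotypic :: "(nat \<Rightarrow> complex) \<Rightarrow> (nat list \<Rightarrow> complex) set" where
  "isotypic y = fs.span {pos_act n k s (h u) | s u. s permutes {..<k} \<and> V.weight_vec y u}"

lemma isotypic_generator:
  "s permutes {..<k} \<Longrightarrow> V.weight_vec y u \<Longrightarrow> pos_act n k s (h u) \<in> isotypic y"
  unfolding isotypic_def by (intro fs.span_base) blast

lemma isotypic_induct [consumes 1, case_names zero step]:
  assumes "F \<in> isotypic y" "P 0"
    and "\<And>c s u G. s permutes {..<k} \<Longrightarrow> V.weight_vec y u \<Longrightarrow> P G \<Longrightarrow>
      P (fscale c (pos_act n k s (h u)) + G)"
  shows "P F"
  using assms(1) unfolding isotypic_def
  by (induction rule: fs.span_induct_alt) (use assms(2,3) in auto)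

lemma isotypic_sub: "isotypic y \<subseteq> schur_module la n"
  unfolding isotypic_def schur_module_def
  by (rule fs.span_mono) (auto simp: V.weight_vec_def intro!: h_schur)

lemma sym_module_isotypic: "sym_module n k (isotypic y)"
proof
  show "fs.subspace (isotypic y)" by (simp add: isotypic_def)
  show "isotypic y \<subseteq> tensor_space n k" using isotypic_sub N.in_TS by blast
  show "pos_act n k s F \<in> isotypic y" if s: "s permutes {..<k}" and "F \<in> isotypic y" for s F
    using that(2)
  proof (induction rule: isotypic_induct)
    case zero show ?case by (simp add: act_0 isotypic_def fs.span_zero)
  next
    case (step c t u G)
    have "pos_act n k s (pos_act n k t (h u)) = pos_act n k (s \<circ> t) (h u)" using s step by (simp add: act_act)
    then have "pos_act n k s (pos_act n k t (h u)) \<in> isotypic y"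
      using isotypic_generator permutes_compose[OF step(1) s] step(2) by simp
    with step(3) show ?case by (simp add: act_add act_scale isotypic_def fs.span_add fs.span_scale)
  qed
qed

text \<open>Equivariance of \<open>h\<close> carries the Jucys-Murphy eigenvalues over to the action
  on letters, and permuting positions commutes with that action.\<close>

lemma isotypic_eigen:
  assumes "F \<in> isotypic y" "j < n"
  shows "(\<Sum>i<j. act_T n k (transpose i j) F) = fscale (y j) F"
  using assms(1)
proof (induction rule: isotypic_induct)
  case zero show ?case by (simp add: act_T_0)
next
  case (step c s u G)
  have u: "u \<in> specht mu" "jucys_murphy L n j u = fscale (y j) u"
    using step(2) assms(2) by (auto simp: V.weight_vec_def)
  have tr: "transpose i j permutes {..<n}" if "i < j" for i
    using that assms(2) by (intro transpose_permutes) auto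
  have "(\<Sum>i<j. act_T n k (transpose i j) (pos_act n k s (h u)))
    = (\<Sum>i<j. pos_act n k s (h (pos_act L n (transpose i j) u)))"
    by (intro sum.cong refl) (use step(1) tr u in \<open>simp add: act_T_pos_act h_act\<close>)
  also have "\<dots> = pos_act n k s (h (jucys_murphy L n j u))"
    unfolding jucys_murphy_def by (subst h_sum) (use tr u in \<open>auto intro: V.stable simp: act_sum\<close>)
  finally have *: "(\<Sum>i<j. act_T n k (transpose i j) (pos_act n k s (h u))) = fscale (y j) (pos_act n k s (h u))"
    using u by (simp add: h_scale act_scale)
  have "(\<Sum>i<j. act_T n k (transpose i j) (fscale c (pos_act n k s (h u)) + G))
    = fscale c (\<Sum>i<j. act_T n k (transpose i j) (pos_act n k s (h u))) + (\<Sum>i<j. act_T n k (transpose i j) G)"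
    by (simp add: act_T_add act_T_scale sum.distrib fs.scale_sum_right)
  then show ?case unfolding * step(3) by (simp add: fs.scale_right_distrib fs.scale_left_commute)
qed

lemma isotypic_simple:
  assumes "F \<in> isotypic y" "Suc i < n" "y (Suc i) = y i - 1"
  shows "act_T n k (transpose i (Suc i)) F = - F"
  using assms(1)
proof (induction rule: isotypic_induct)
  case zero show ?case by (simp add: act_T_0)
next
  case (step c s u G)
  have u: "u \<in> specht mu" using step(2) by (simp add: V.weight_vec_def)
  have tr: "transpose i (Suc i) permutes {..<n}" using assms(2) by (intro transpose_permutes) auto
  have "pos_act L n (transpose i (Suc i)) u = - u"
    using V.weight_vec_simple[OF step(2) assms(2)] assms(3) by simp
  then have "act_T n k (transpose i (Suc i)) (pos_act n k s (h u)) = - pos_act n k s (h u)"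
    using step(1) tr u by (simp add: act_T_pos_act h_act[symmetric] h_uminus act_uminus)
  then show ?case by (simp add: act_T_add act_T_scale step(3))
qed

lemma isotypic_intertwiner:
  assumes "F \<in> isotypic y" "Suc i < n" "y i \<noteq> y (Suc i)"
  shows "act_T n k (transpose i (Suc i)) F - fscale (1 / (y (Suc i) - y i)) F \<in> isotypic (y \<circ> transpose i (Suc i))"
  using assms(1)
proof (induction rule: isotypic_induct)
  case zero show ?case by (simp add: act_T_0 isotypic_def fs.span_zero)
next
  case (step c s u G)
  let ?d = "1 / (y (Suc i) - y i)" and ?t = "transpose i (Suc i)"
  have u: "u \<in> specht mu" using step(2) by (simp add: V.weight_vec_def)
  have tr: "?t permutes {..<n}" using assms(2) by (intro transpose_permutes) auto
  have "pos_act n k s (h (pos_act L n ?t u - fscale ?d u)) \<in> isotypic (y \<circ> ?t)"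
    by (intro isotypic_generator V.weight_vec_intertwiner step assms)
  also have "pos_act n k s (h (pos_act L n ?t u - fscale ?d u))
    = act_T n k ?t (pos_act n k s (h u)) - fscale ?d (pos_act n k s (h u))"
    using step(1) tr u V.stable[OF tr u] V.subspace
    by (simp add: h_diff fs.subspace_scale h_act h_scale act_T_pos_act act_diff act_scale)
  finally have "fscale c (act_T n k ?t (pos_act n k s (h u)) - fscale ?d (pos_act n k s (h u)))
    + (act_T n k ?t G - fscale ?d G) \<in> isotypic (y \<circ> ?t)"
    using step(3) unfolding isotypic_def by (intro fs.span_add fs.span_scale)
  also have "fscale c (act_T n k ?t (pos_act n k s (h u)) - fscale ?d (pos_act n k s (h u)))
    + (act_T n k ?t G - fscale ?d G)
    = act_T n k ?t (fscale c (pos_act n k s (h u)) + G) - fscale ?d (fscale c (pos_act n k s (h u)) + G)"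
    by (simp add: act_T_add act_T_scale fs.scale_right_diff_distrib fs.scale_right_distrib fs.scale_left_commute)
  finally show ?case .
qed

text \<open>If the Specht module had only the zero vector of weight \<open>y\<close>, all generators
  would vanish.\<close>

lemma isotypic_weight:
  assumes "F \<in> isotypic y" "F \<noteq> 0" shows "V.is_weight y"
proof (rule ccontr)
  assume "\<not> ?thesis"
  then have z: "u = 0" if "V.weight_vec y u" for u using that by (auto simp: V.is_weight_def)
  from assms(1) have "F = 0"
  proof (induction rule: isotypic_induct)
    case (step c s u G) then show ?case using z[OF step(2)] by (simp add: h_0 act_0)
  qed simp
  with assms(2) show False by simp
qed

text \<open>The letter weight is recorded by membership in \<open>isotypic y\<close> instead of
  eigenvalue equations: this keeps the link to the Specht module, which ties \<open>y\<close> to the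
  shape of \<open>mu\<close>.\<close>

definition joint_weight :: "(nat \<Rightarrow> complex) \<Rightarrow> (nat \<Rightarrow> complex) \<Rightarrow> (nat list \<Rightarrow> complex) \<Rightarrow> bool" where
  "joint_weight y x F \<longleftrightarrow> F \<in> isotypic y \<and> (\<forall>j<k. jucys_murphy n k j F = fscale (x j) F)"

lemma joint_weight_witness:
  assumes u: "u \<in> specht mu" and g: "g permutes {..<n}" and s: "s permutes {..<k}"
    and nz: "pos_act n k s (act_T n k g (h u)) w \<noteq> 0"
  shows "\<exists>y x F. joint_weight y x F \<and> F w \<noteq> 0"
proof -
  define l where "l u = pos_act n k s (h u) w" for u
  have gu: "pos_act L n g u \<in> specht mu" by (rule V.stable[OF g u])
  \<comment> \<open>First decomposition, by letters, carried out in the Specht module before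
    \<open>h\<close> is applied.\<close>
  have "\<exists>v\<in>{v. \<exists>a. V.weight_vec a v}. l v \<noteq> 0"
  proof (rule span_nonzero_witness)
    show "pos_act L n g u \<in> fs.span {v. \<exists>a. V.weight_vec a v}" by (rule V.span_weight_vecs[OF gu])
    show "l (pos_act L n g u) \<noteq> 0" using nz by (simp add: l_def h_act[OF u g])
    show "l 0 = 0" by (simp add: l_def h_0 act_0 zero_fun_apply)
    have sub: "fs.span {v. \<exists>a. V.weight_vec a v} \<subseteq> specht mu"
      by (rule fs.span_minimal[OF _ V.subspace]) (auto simp: V.weight_vec_def)
    fix c x y assume "x \<in> {v. \<exists>a. V.weight_vec a v}" "y \<in> fs.span {v. \<exists>a. V.weight_vec a v}"
    then have "x \<in> specht mu" "y \<in> specht mu" using sub by (auto simp: V.weight_vec_def)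
    then show "l (fscale c x + y) = c * l x + l y"
      by (simp add: l_def h_add h_scale V.subspace fs.subspace_scale act_add act_scale fun_apply)
  qed
  then obtain v y where v: "V.weight_vec y v" "pos_act n k s (h v) w \<noteq> 0" by (auto simp: l_def)
  interpret E: sym_module n k "isotypic y" by (rule sym_module_isotypic)
  \<comment> \<open>Second decomposition, by positions, inside the S_k-stable subspace belonging to
    the letter weight just found.\<close>
  have "pos_act n k s (h v) \<in> fs.span {F. \<exists>x. E.weight_vec x F}"
    by (intro E.span_weight_vecs isotypic_generator s v)
  then have "\<exists>F\<in>{F. \<exists>x. E.weight_vec x F}. F w \<noteq> 0"
    by (rule span_nonzero_witness[where l = "\<lambda>F. F w"]) (use v in \<open>auto simp: fun_apply\<close>)
  then show ?thesis by (auto simp: joint_weight_def E.weight_vec_def)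
qed

lemma isotypic_cong: "(\<And>j. j < n \<Longrightarrow> y j = y' j) \<Longrightarrow> isotypic y = isotypic y'"
proof -
  assume "\<And>j. j < n \<Longrightarrow> y j = y' j"
  then have "V.weight_vec y u = V.weight_vec y' u" for u by (simp add: V.weight_vec_def)
  then show ?thesis by (simp add: isotypic_def)
qed

text \<open>Evaluation at \<open>w\<close> is invariant under transposing two letters that do not occur in \<open>w\<close>, so the
  intertwiner scales it by a nonzero factor, and a sign eigenvector would vanish there.\<close>
lemma sorted_joint_weight:
  assumes "joint_weight y x F" "F w \<noteq> 0" "set w = {..<m}" "w \<in> words n k"
  shows "\<exists>c x F. joint_weight (\<lambda>i. of_int (c i)) x F \<and> F w \<noteq> 0 \<and>
    (\<forall>i. m \<le> i \<longrightarrow> Suc i < n \<longrightarrow> c i \<le> c (Suc i))"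
proof -
  define P where "P c \<longleftrightarrow> (\<exists>x F. joint_weight (\<lambda>i. of_int (c i)) x F \<and> F w \<noteq> 0)" for c :: "nat \<Rightarrow> int"
  have nz: "F \<noteq> 0" if "F w \<noteq> 0" for F :: "nat list \<Rightarrow> complex" using that by (auto simp: zero_fun_apply)
  have "V.is_weight y" using assms(1,2) isotypic_weight nz by (auto simp: joint_weight_def)
  then obtain c where "\<forall>j<n. y j = of_int (c j)" using V.weight_shape by blast
  then have "isotypic (\<lambda>i. of_int (c i)) = isotypic y" by (intro isotypic_cong) auto
  then have "P c" using assms(1,2) by (auto simp: P_def joint_weight_def)
  then have "\<exists>c'. P c' \<and> (\<forall>i. m \<le> i \<longrightarrow> Suc i < n \<longrightarrow> c' i \<le> c' (Suc i))"
  proof (rule sort_by_adjacent_swaps[where key = "\<lambda>c. c"])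
    fix c i assume P: "P c" and i: "m \<le> i" "Suc i < n" and desc: "c (Suc i) < c i"
    let ?t = "transpose i (Suc i)" and ?y = "\<lambda>i. complex_of_int (c i)"
    from P obtain x F where F: "joint_weight ?y x F" "F w \<noteq> 0" by (auto simp: P_def)
    have FE: "F \<in> isotypic ?y" using F by (simp add: joint_weight_def)
    have tr: "?t permutes {..<n}" using i by (intro transpose_permutes) auto
    have "map ?t w = w" using assms(3) i by (intro map_idI) (auto simp: transpose_def)
    then have fix_w: "act_T n k ?t G w = G w" for G using assms(4) by (simp add: act_T_def)
    have "c (Suc i) \<noteq> c i - 1"
    proof
      assume "c (Suc i) = c i - 1"
      then have "act_T n k ?t F = - F" using FE i by (intro isotypic_simple) auto
      then show False using fix_w[of F] F(2) by (simp add: fun_apply)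
    qed
    \<comment> \<open>A descent by exactly 1 is ruled out, so the remaining descents are admissible
      swaps.\<close>
    then have lt: "c (Suc i) - c i < - 1" using desc by simp
    define d where "d = complex_of_int (c (Suc i) - c i)"
    have d: "d \<noteq> 0" "d \<noteq> 1"
      unfolding d_def of_int_eq_0_iff of_int_eq_1_iff using lt by linarith+
    let ?G = "act_T n k ?t F - fscale (1 / d) F"
    have "?G \<in> isotypic (?y \<circ> ?t)"
      using isotypic_intertwiner[OF FE i(2)] lt by (auto simp: d_def)
    moreover have "?y \<circ> ?t = (\<lambda>j. of_int ((c \<circ> ?t) j))" by (simp add: comp_def)
    ultimately have GE: "?G \<in> isotypic (\<lambda>j. of_int ((c \<circ> ?t) j))" by simp
    have "jucys_murphy n k j ?G = fscale (x j) ?G" if j: "j < k" for j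
    proof -
      have "jucys_murphy n k j (act_T n k ?t F) = act_T n k ?t (jucys_murphy n k j F)"
      proof -
        have "act_T n k ?t (\<Sum>i\<in>A. f i) = (\<Sum>i\<in>A. act_T n k ?t (f i))" for A :: "nat set" and f
          by (induction A rule: infinite_finite_induct) (auto simp: act_T_add act_T_0)
        then show ?thesis unfolding jucys_murphy_def
          by (auto intro!: sum.cong act_T_pos_act[OF tr, symmetric] transpose_permutes simp: j less_trans[OF _ j])
      qed
      then show ?thesis using F j
        by (simp add: joint_weight_def jm_diff jm_scale act_T_scale fs.scale_right_diff_distrib fs.scale_left_commute)
    qed
    \<comment> \<open>\<open>?G w\<close> equals \<open>(1 - 1 / d) * F w\<close>, since the letter
      transposition does not affect the value at \<open>w\<close>.\<close>
    moreover have "?G w \<noteq> 0" using fix_w[of F] F(2) d by (simp add: fun_apply field_simps)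
    ultimately have "P (c \<circ> ?t)" using GE by (auto simp: P_def joint_weight_def)
    then show "\<exists>c'. P c' \<and> c' = c \<circ> ?t" by blast
  qed
  then show ?thesis by (auto simp: P_def)
qed

text \<open>For letters below \<open>b\<close>, each standing exactly at the position of its own
  number, renaming \<open>i\<close> and \<open>j\<close> in \<open>w\<close> has the same effect as
  exchanging the positions \<open>i\<close> and \<open>j\<close>. Summed over \<open>i < j\<close>,
  both Jucys-Murphy elements take the same value at \<open>w\<close>.\<close>

lemma weights_agree:
  assumes F: "joint_weight y x F" "F w \<noteq> 0" and w: "w \<in> words n k"
    and fix_b: "\<forall>j<b. w ! j = j" "\<forall>i<k. \<forall>j<b. w ! i = j \<longrightarrow> i = j"
    and j: "j < b" "b \<le> k" "b \<le> n"
  shows "x j = y j"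
proof -
  have lw: "length w = k" using w by (simp add: words_def)
  have "pos_act n k (transpose i j) F w = act_T n k (transpose i j) F w" if "i < j" for i
  proof -
    have "map (\<lambda>p. w ! transpose i j p) [0..<k] = map (transpose i j) w"
    proof (rule nth_equalityI)
      fix p assume "p < length (map (\<lambda>p. w ! transpose i j p) [0..<k])"
      then have p: "p < k" by simp
      show "map (\<lambda>p. w ! transpose i j p) [0..<k] ! p = map (transpose i j) w ! p"
        using p fix_b(1)[rule_format, of i] fix_b(1)[rule_format, of j] fix_b(2)[rule_format, of p i] fix_b(2)[rule_format, of p j] that j lw
        by (cases "p = i"; cases "p = j") (auto simp: transpose_def)
    qed (simp add: lw)
    then show ?thesis using w by (simp add: pos_act_def act_T_def)
  qed
  then have "jucys_murphy n k j F w = (\<Sum>i<j. act_T n k (transpose i j) F) w"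
    by (simp add: jucys_murphy_def sum_fun_apply)
  also have "\<dots> = y j * F w" using isotypic_eigen[of F y j] F j by (simp add: joint_weight_def fscale_apply)
  finally show ?thesis using F j by (simp add: joint_weight_def fscale_apply)
qed

lemma card_overlap:
  assumes u: "u \<in> specht mu" "h u \<noteq> 0"
  shows "2 * card {(i, j). (Suc i, j) \<in> diagram mu} \<le> card (diagram la \<inter> {(i, j). (Suc i, j) \<in> diagram mu}) + k"
proof -
  \<comment> \<open>The boxes of \<open>mu\<close> with a box directly below; moving the lower rows
    up by one shows that this is the diagram of \<open>hat mu\<close>.\<close>
  let ?H = "{(i, j). (Suc i, j) \<in> diagram mu}"
  have "h u \<in> tensor_space n k" by (rule schur_tensor_space[OF h_schur[OF u(1)]])
  with u(2) obtain w where w: "w \<in> words n k" "h u w \<noteq> 0"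
    by (auto simp: tensor_space_def fun_eq_iff zero_fun_apply)
  obtain g s w0 m b where g: "g permutes {..<n}" and s: "s permutes {..<k}"
    and w0: "w0 \<in> words n k" "map (inv g) (map (\<lambda>i. w0 ! inv s i) [0..<k]) = w" "set w0 = {..<m}"
    and fix_b: "\<forall>j<b. w0 ! j = j" "\<forall>i<k. \<forall>j<b. w0 ! i = j \<longrightarrow> i = j"
    and le: "b \<le> m" "m \<le> n" "b \<le> k" "2 * m \<le> b + k" by (rule word_normal_form[OF w(1)])
  have si: "inv s permutes {..<k}" by (rule permutes_inv[OF s])
  \<comment> \<open>Moving the vector along with the word lets the argument continue at the normal
    form \<open>w0\<close>.\<close>
  have "pos_act n k (inv s) (act_T n k g (h u)) w0 = h u w"
    using w0 reindex_words[OF w0(1) si] by (simp add: pos_act_def act_T_def)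
  then obtain y x F where "joint_weight y x F" "F w0 \<noteq> 0"
    using joint_weight_witness[OF u(1) g si, of w0] w(2) by auto
  from sorted_joint_weight[OF this w0(3,1)] obtain c x F where F: "joint_weight (\<lambda>i. of_int (c i)) x F" "F w0 \<noteq> 0"
    and sorted: "\<And>i. m \<le> i \<Longrightarrow> Suc i < n \<Longrightarrow> c i \<le> c (Suc i)" by blast
  have F0: "F \<noteq> 0" using F(2) by (auto simp: zero_fun_apply)
  have wc: "V.is_weight (\<lambda>i. of_int (c i))" using F(1) F0 isotypic_weight by (auto simp: joint_weight_def)
  then obtain c' where "\<forall>j<n. complex_of_int (c j) = of_int (c' j)" "content_sequence n c'"
    "content_box c' ` {..<n} = diagram mu" using V.weight_shape by blast
  then have cc: "\<And>j. j < n \<Longrightarrow> c j = c' j" and cs: "content_sequence n c'"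
    and cmu: "content_box c' ` {..<n} = diagram mu" by auto
  interpret c': content_sequence n c' by (rule cs)
  have "F \<in> schur_module la n" using F(1) isotypic_sub by (auto simp: joint_weight_def)
  then have "N.is_weight x" using F(1) F0 by (auto simp: N.is_weight_def N.weight_vec_def joint_weight_def)
  then obtain d where d: "\<forall>j<k. x j = of_int (d j)" "content_sequence k d" "content_box d ` {..<k} = diagram la"
    using N.weight_shape by blast
  have dc: "d j = c' j" if "j < b" for j
  proof -
    have "complex_of_int (d j) = of_int (c j)"
      using weights_agree[OF F w0(1) fix_b that] le d(1) that by auto
    then show ?thesis using cc[of j] that le by simp
  qed
  define A where "A = content_box c' ` {..<b}"
  define M where "M = content_box c' ` {..<m}"
  \<comment> \<open>The first \<open>b\<close> contents agree, and a box depends only on the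
    contents up to its step, so both tableaux start with the same boxes.\<close>
  have "content_box d ` {..<b} = A" unfolding A_def by (intro image_cong refl content_box_cong dc) auto
  then have A_la: "A \<subseteq> diagram la" using d(3) le by auto
  have A_M: "A \<subseteq> M" using le by (auto simp: A_def M_def)
  have cards: "card A = b" "card M = m"
    by (simp_all add: A_def M_def card_image inj_on_subset[OF inj_content_box])
  \<comment> \<open>Consecutive entries of a weight differ, so the sorted tail increases
    strictly.\<close>
  have strict: "c' p < c' q" if "m \<le> p" "p < q" "q < n" for p q
  proof -
    have step: "c' i < c' (Suc i)" if "m \<le> i" "Suc i < n" for i
    proof -
      have "c' i \<noteq> c' (Suc i)"
        using content_system.weight_neq[OF V.content_system wc that(2)] that by (simp add: cc)
      then show ?thesis using sorted[OF that] that by (simp add: cc)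
    qed
    have "Suc p \<le> q" using that by simp
    then show ?thesis using that(3)
      by (induction q rule: dec_induct) (use step that(1) in \<open>auto intro: less_trans\<close>)
  qed
  \<comment> \<open>A box and the one below it are added in this order with the content dropping by
    1. Within the strictly increasing tail this is impossible, so the upper box is among the first
    \<open>m\<close>.\<close>
  have H_M: "?H \<subseteq> M"
  proof clarify
    fix i j assume ij: "(Suc i, j) \<in> diagram mu"
    then have "(i, j) \<in> diagram mu" using downsetD[OF V.D(1), of "Suc i" j i j] by simp
    with ij obtain p q where pq: "p < n" "content_box c' p = (i, j)" "q < n" "content_box c' q = (Suc i, j)"
      using cmu by (metis (no_types, lifting) imageE lessThan_iff)
    then have "p < q" using c'.content_box_order[of q p] by fastforce
    moreover have "c' q < c' p" using content_box_content[of c' p] content_box_content[of c' q] pq by simp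
    ultimately have "p < m" using strict[of p q] pq by (meson not_le less_asym)
    then show "(i, j) \<in> M" using pq(2) unfolding M_def by (metis imageI lessThan_iff)
  qed
  have fin: "finite M" by (simp add: M_def)
  have finA: "finite A" by (simp add: A_def)
  have finH: "finite ?H" using finite_subset[OF H_M fin] .
  \<comment> \<open>Combined with \<open>card (A \<union> ?H) \<le> m\<close>,
    \<open>card ?H \<le> m\<close> and \<open>2 * m \<le> b + k\<close>, this is the claim.\<close>
  have "card A + card ?H = card (A \<union> ?H) + card (A \<inter> ?H)" by (rule card_Un_Int[OF finA finH])
  moreover have "card (A \<union> ?H) \<le> card M" using A_M H_M fin by (intro card_mono) auto
  moreover have "card (A \<inter> ?H) \<le> card (diagram la \<inter> ?H)"
    using A_la finH by (intro card_mono) auto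
  moreover have "card ?H \<le> card M" using H_M fin by (rule card_mono[rotated])
  ultimately show ?thesis using cards le by linarith
qed

end

lemma diagram_hat: "diagram (hat mu) = {(i, j). (Suc i, j) \<in> diagram mu}"
  by (cases mu) (auto simp: diagram_def hat_def)

text \<open>\<open>zip\<close> stops at the shorter list, and below that row the intersection has no
  boxes.\<close>

lemma diagram_pinter: "diagram (pinter la mu) = diagram la \<inter> diagram mu"
  by (auto simp: diagram_def pinter_def)

theorem theorem1p2:
  fixes la mu :: "nat list"
  assumes "is_partition la" and "is_partition mu"
    and "r_mult la mu > 0"
  shows "int (psize (pinter la (hat mu))) \<ge> 2 * int (psize (hat mu)) - int (psize la)"
proof -
  obtain h u where hu: "h \<in> equiv_homs la mu" "u \<in> specht mu" "h u \<noteq> 0"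
    using nonzero_hom_if_r_mult_pos[OF assms(3)] .
  interpret specht_hom la mu h by unfold_locales (use assms hu in auto)
  have "2 * psize (hat mu) \<le> psize (pinter la (hat mu)) + psize la"
    using card_overlap[OF hu(2,3)]
    by (simp only: card_diagram[symmetric, of "hat mu"] card_diagram[symmetric, of "pinter la (hat mu)"]
        diagram_pinter diagram_hat)
  then show ?thesis by linarith
qed

end
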